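(* Let $\mathbb{H}_1,\ldots,\mathbb{H}_n$ be complex Hilbert spaces and, for $i=1,\ldots,n$, let $T_i$ be a contraction on $\mathbb{H}_i$ whose spectrum $\sigma(T_i)$ contains the unit circle $\mathbb{T}$. Put \[\tilde T_1=T_1\otimes I^{\otimes(n-1)},\quad \tilde T_2=I\otimes T_2\otimes I^{\otimes(n-2)},\ \ldots,\ \tilde T_n=I^{\otimes(n-1)}\otimes T_n.\] Then the map $f:\ell^1(n)\to\mathcal{B}(\mathbb{H}_1\otimes\cdots\otimes\mathbb{H}_n)$ defined by $f(a_1,\ldots,a_n)=a_1\tilde T_1+\cdots+a_n\tilde T_n$ is an isometry.
   Context: $\ell^1(n)$ is $\mathbb{C}^n$ with the norm $\|(a_1,\ldots,a_n)\|_1=\sum_i|a_i|$; tensor products are Hilbert space tensor products, with the $i$-th factor acting on $\mathbb{H}_i$. *)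

theory Defs
  imports "HOL-Analysis.Analysis" "HOL-Algebra.Algebraic_Closure_Type"
begin

text \<open>
  Hilbert spaces live on carrier sets, so that one family \<open>H :: nat \<Rightarrow> 'a hspace\<close> can consist of
  different spaces (any finite family of sets embeds disjointly into one type). As usual for
  \<open>module\<close> records, the ring fields \<open>mult\<close> and \<open>one\<close> of a Hilbert space carry no meaning.
\<close>

record 'a hspace = "(complex, 'a) module" +
  hinner :: "'a \<Rightarrow> 'a \<Rightarrow> complex"

abbreviation complex_field :: "complex ring" where
  "complex_field \<equiv> ring_of_type_algebra"

definition hnorm :: "'a hspace \<Rightarrow> 'a \<Rightarrow> real" where
  "hnorm H x = sqrt (Re (hinner H x x))"

text \<open>The value outside the carrier is immaterial; it only serves the totality requirements
  of the locale \<open>Metric_space\<close>.\<close>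

definition hdist :: "'a hspace \<Rightarrow> 'a \<Rightarrow> 'a \<Rightarrow> real" where
  "hdist H x y = (if x \<in> carrier H \<and> y \<in> carrier H then hnorm H (x \<ominus>\<^bsub>H\<^esub> y) else 0)"

text \<open>Inner products are linear in the first argument.\<close>

locale complex_inner_space = Module.module complex_field H for H :: "'a hspace" (structure) +
  assumes hinner_add_left:
      "\<lbrakk>x \<in> carrier H; y \<in> carrier H; z \<in> carrier H\<rbrakk>
        \<Longrightarrow> hinner H (x \<oplus> y) z = hinner H x z + hinner H y z"
    and hinner_smult_left:
      "\<lbrakk>x \<in> carrier H; z \<in> carrier H\<rbrakk> \<Longrightarrow> hinner H (c \<odot> x) z = c * hinner H x z"
    and hinner_commute:
      "\<lbrakk>x \<in> carrier H; y \<in> carrier H\<rbrakk> \<Longrightarrow> hinner H y x = cnj (hinner H x y)"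
    and hinner_nonneg:
      "x \<in> carrier H \<Longrightarrow> 0 \<le> Re (hinner H x x)"
    and hinner_definite:
      "\<lbrakk>x \<in> carrier H; hinner H x x = 0\<rbrakk> \<Longrightarrow> x = \<zero>"

locale complex_hilbert_space = complex_inner_space +
  assumes complete: "Metric_space.mcomplete (carrier H) (hdist H)"

context complex_inner_space
begin

lemma smult_closed_complex [simp, intro]: "x \<in> carrier H \<Longrightarrow> c \<odot> x \<in> carrier H"
  using smult_closed by (simp add: ring_of_type_algebra_def)

lemma smult_one_complex: "x \<in> carrier H \<Longrightarrow> 1 \<odot> x = x"
  using smult_one by (simp add: ring_of_type_algebra_def)

lemma smult_add_complex: "x \<in> carrier H \<Longrightarrow> (c + d) \<odot> x = c \<odot> x \<oplus> d \<odot> x"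
  using smult_l_distr[of c d x] by (simp add: ring_of_type_algebra_def)

lemma hinner_zero_left [simp]: "z \<in> carrier H \<Longrightarrow> hinner H \<zero> z = 0"
  using hinner_add_left[of "\<zero>" "\<zero>" z] by simp

lemma a_inv_eq_smult: 
  assumes "x \<in> carrier H" shows "\<ominus> x = (-1) \<odot> x"
proof -
  have z: "0 \<odot> x = \<zero>"
    using smult_l_null[OF assms] by (simp add: ring_of_type_algebra_def)
  have "x \<oplus> (-1) \<odot> x = \<zero>"
    using smult_add_complex[OF assms, of 1 "-1"] assms by (simp add: smult_one_complex z)
  then have "(-1) \<odot> x \<oplus> x = \<zero>"
    using assms by (simp add: M.a_comm)
  then show ?thesis
    using assms M.minus_equality smult_closed_complex by blast
qed

lemma hinner_minus_left:
  assumes "x \<in> carrier H" "z \<in> carrier H" shows "hinner H (\<ominus> x) z = - hinner H x z"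
  using assms by (simp add: a_inv_eq_smult hinner_smult_left)

lemma hinner_add_right:
  assumes "x \<in> carrier H" "y \<in> carrier H" "z \<in> carrier H"
  shows "hinner H z (x \<oplus> y) = hinner H z x + hinner H z y"
  using assms hinner_commute[of "x \<oplus> y" z] hinner_commute[of x z] hinner_commute[of y z]
  by (simp add: hinner_add_left)

lemma hinner_smult_right:
  assumes "x \<in> carrier H" "z \<in> carrier H"
  shows "hinner H z (c \<odot> x) = cnj c * hinner H z x"
  using assms hinner_commute[of "c \<odot> x" z] hinner_commute[of x z]
  by (simp add: hinner_smult_left)

lemma hinner_self_Re: "x \<in> carrier H \<Longrightarrow> hinner H x x = of_real (Re (hinner H x x))"
  using hinner_commute[of x x] by (simp add: complex_eq_iff)

lemma hnorm_sq: "x \<in> carrier H \<Longrightarrow> (hnorm H x)\<^sup>2 = Re (hinner H x x)"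
  by (simp add: hnorm_def hinner_nonneg)

lemma hnorm_nonneg: "x \<in> carrier H \<Longrightarrow> 0 \<le> hnorm H x"
  by (simp add: hnorm_def hinner_nonneg)

lemma hnorm_eq_0_iff: "x \<in> carrier H \<Longrightarrow> hnorm H x = 0 \<longleftrightarrow> x = \<zero>"
  using hinner_self_Re[of x] hinner_definite[of x] by (auto simp: hnorm_def)

lemma hnorm_minus: "x \<in> carrier H \<Longrightarrow> hnorm H (\<ominus> x) = hnorm H x"
  by (simp add: hnorm_def a_inv_eq_smult hinner_smult_left hinner_smult_right)

lemma Cauchy_Schwarz:
  assumes x: "x \<in> carrier H" and y: "y \<in> carrier H"
  shows "cmod (hinner H x y) \<le> hnorm H x * hnorm H y"
proof (cases "y = \<zero>")
  case True
  then show ?thesis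
    using hinner_commute[of y x] x y by (simp add: hnorm_nonneg)
next
  case False
  define b where "b = Re (hinner H y y)"
  define c where "c = hinner H x y"
  have yy: "hinner H y y = of_real b" using hinner_self_Re[OF y] by (simp add: b_def)
  have b: "b > 0"
    using False hinner_definite[OF y] hinner_nonneg[OF y] yy unfolding b_def
    by (metis less_eq_real_def of_real_0)
  define z where "z = x \<oplus> (- (c / b)) \<odot> y"
  have z: "z \<in> carrier H" using x y by (simp add: z_def)
  have yx: "hinner H y x = cnj c" using hinner_commute[OF x y] by (simp add: c_def)
  have "hinner H z z = hinner H x x - c * cnj c / b"
    using b x y unfolding z_def
    by (simp add: hinner_add_left hinner_add_right hinner_smult_left hinner_smult_right yy yx
        flip: c_def)
  then have "Re (hinner H z z) = Re (hinner H x x) - (cmod c)\<^sup>2 / b"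
    by (metis Re_complex_of_real complex_norm_square minus_complex.simps(1) of_real_divide)
  then have "(cmod c)\<^sup>2 / b \<le> Re (hinner H x x)"
    using hinner_nonneg[OF z] by linarith
  then have "(cmod c)\<^sup>2 \<le> (hnorm H x * hnorm H y)\<^sup>2"
    using b x y by (simp add: power_mult_distrib hnorm_sq pos_divide_le_eq b_def)
  then show ?thesis
    unfolding c_def
    by (rule power2_le_imp_le) (simp add: x y hnorm_nonneg)
qed

lemma hnorm_triangle:
  assumes x: "x \<in> carrier H" and y: "y \<in> carrier H"
  shows "hnorm H (x \<oplus> y) \<le> hnorm H x + hnorm H y"
proof -
  have "(hnorm H (x \<oplus> y))\<^sup>2 = (hnorm H x)\<^sup>2 + (hnorm H y)\<^sup>2 + 2 * Re (hinner H x y)"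
    using x y hinner_commute[OF x y] by (simp add: hnorm_sq hinner_add_left hinner_add_right)
  also have "\<dots> \<le> (hnorm H x)\<^sup>2 + (hnorm H y)\<^sup>2 + 2 * (hnorm H x * hnorm H y)"
    using Cauchy_Schwarz[OF x y] complex_Re_le_cmod[of "hinner H x y"] by linarith
  also have "\<dots> = (hnorm H x + hnorm H y)\<^sup>2"
    by (simp add: power2_sum)
  finally show ?thesis
    by (rule power2_le_imp_le) (simp add: x y hnorm_nonneg)
qed

lemma Metric_space_hdist: "Metric_space (carrier H) (hdist H)"
proof
  show "0 \<le> hdist H x y" for x y
    by (simp add: hdist_def hnorm_nonneg)
  show "hdist H x y = hdist H y x" for x y
  proof (cases "x \<in> carrier H \<and> y \<in> carrier H")
    case True
    then have "y \<ominus> x = \<ominus> (x \<ominus> y)"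
      by (simp add: M.minus_eq M.minus_add M.a_comm)
    then show ?thesis
      using True by (simp add: hdist_def hnorm_minus)
  qed (auto simp: hdist_def)
  show "hdist H x y = 0 \<longleftrightarrow> x = y" if "x \<in> carrier H" "y \<in> carrier H" for x y
  proof -
    have "x = y" if "x \<ominus> y = \<zero>"
      using that \<open>x \<in> carrier H\<close> \<open>y \<in> carrier H\<close> M.minus_equality[of x "\<ominus> y"]
      by (simp add: M.minus_eq)
    then show ?thesis
      using that by (auto simp: hdist_def hnorm_eq_0_iff M.minus_eq M.r_neg)
  qed
  show "hdist H x z \<le> hdist H x y + hdist H y z"
    if "x \<in> carrier H" "y \<in> carrier H" "z \<in> carrier H" for x y z
  proof -
    have "x \<ominus> z = (x \<ominus> y) \<oplus> (y \<ominus> z)"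
      using that by (simp add: M.minus_eq M.a_assoc M.r_neg1)
    then show ?thesis
      using that hnorm_triangle[of "x \<ominus> y" "y \<ominus> z"] by (simp add: hdist_def)
  qed
qed

end

definition hspan :: "'a hspace \<Rightarrow> 'a set \<Rightarrow> 'a set" where
  "hspan H S = {v. \<exists>F c. finite F \<and> F \<subseteq> S \<and> v = (\<Oplus>\<^bsub>H\<^esub>u\<in>F. c u \<odot>\<^bsub>H\<^esub> u)}"

definition hdense :: "'a hspace \<Rightarrow> 'a set \<Rightarrow> bool" where
  "hdense H S \<longleftrightarrow> Metric_space.mtopology (carrier H) (hdist H) closure_of S = carrier H"

text \<open>Operators are extensional functions on the carrier, so that equality of operators is
  equality of HOL functions.\<close>

definition bounded_operators :: "'a hspace \<Rightarrow> ('a \<Rightarrow> 'a) set" where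
  "bounded_operators H = {S \<in> carrier H \<rightarrow>\<^sub>E carrier H.
     (\<forall>x\<in>carrier H. \<forall>y\<in>carrier H. S (x \<oplus>\<^bsub>H\<^esub> y) = S x \<oplus>\<^bsub>H\<^esub> S y) \<and>
     (\<forall>c. \<forall>x\<in>carrier H. S (c \<odot>\<^bsub>H\<^esub> x) = c \<odot>\<^bsub>H\<^esub> S x) \<and>
     (\<exists>C. \<forall>x\<in>carrier H. hnorm H (S x) \<le> C * hnorm H x)}"

text \<open>The algebra \<open>\<B> H\<close>, with composition as multiplication.\<close>

definition \<B> :: "'a hspace \<Rightarrow> (complex, 'a \<Rightarrow> 'a) module" where
  "\<B> H = \<lparr>carrier = bounded_operators H,
     monoid.mult = (\<lambda>R S. compose (carrier H) R S),
     one = (\<lambda>x\<in>carrier H. x),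
     zero = (\<lambda>x\<in>carrier H. \<zero>\<^bsub>H\<^esub>),
     add = (\<lambda>R S. \<lambda>x\<in>carrier H. R x \<oplus>\<^bsub>H\<^esub> S x),
     smult = (\<lambda>c S. \<lambda>x\<in>carrier H. c \<odot>\<^bsub>H\<^esub> S x)\<rparr>"

definition opnorm :: "'a hspace \<Rightarrow> ('a \<Rightarrow> 'a) \<Rightarrow> real" where
  "opnorm H S = (SUP x\<in>{x \<in> carrier H. hnorm H x \<le> 1}. hnorm H (S x))"

definition contraction :: "'a hspace \<Rightarrow> ('a \<Rightarrow> 'a) \<Rightarrow> bool" where
  "contraction H S \<longleftrightarrow> S \<in> carrier (\<B> H) \<and> opnorm H S \<le> 1"

definition spectrum :: "'a hspace \<Rightarrow> ('a \<Rightarrow> 'a) \<Rightarrow> complex set" where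
  "spectrum H S = {z. S \<ominus>\<^bsub>\<B> H\<^esub> z \<odot>\<^bsub>\<B> H\<^esub> \<one>\<^bsub>\<B> H\<^esub> \<notin> Units (\<B> H)}"

text \<open>
  \<open>(K, \<tau>)\<close> is a Hilbert space tensor product of \<open>H 1, \<dots>, H n\<close>, with \<open>\<tau> x\<close> the elementary tensor
  \<open>x 1 \<otimes> \<dots> \<otimes> x n\<close>: the span of the elementary tensors is the algebraic tensor product with its
  usual inner product, and \<open>K\<close> is its completion. This determines \<open>(K, \<tau>)\<close> up to a unique
  unitary isomorphism.
\<close>

definition hilbert_tensor_product ::
    "nat \<Rightarrow> (nat \<Rightarrow> 'a hspace) \<Rightarrow> 'k hspace \<Rightarrow> ((nat \<Rightarrow> 'a) \<Rightarrow> 'k) \<Rightarrow> bool" where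
  "hilbert_tensor_product n H K \<tau> \<longleftrightarrow>
     complex_hilbert_space K \<and>
     \<tau> \<in> (\<Pi>\<^sub>E i\<in>{1..n}. carrier (H i)) \<rightarrow> carrier K \<and>
     (\<forall>x \<in> \<Pi>\<^sub>E i\<in>{1..n}. carrier (H i). \<forall>i\<in>{1..n}. \<forall>u\<in>carrier (H i). \<forall>v\<in>carrier (H i).
        \<tau> (x(i := u \<oplus>\<^bsub>H i\<^esub> v)) = \<tau> (x(i := u)) \<oplus>\<^bsub>K\<^esub> \<tau> (x(i := v))) \<and>
     (\<forall>x \<in> \<Pi>\<^sub>E i\<in>{1..n}. carrier (H i). \<forall>i\<in>{1..n}. \<forall>c. \<forall>u\<in>carrier (H i).
        \<tau> (x(i := c \<odot>\<^bsub>H i\<^esub> u)) = c \<odot>\<^bsub>K\<^esub> \<tau> (x(i := u))) \<and>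
     (\<forall>x \<in> \<Pi>\<^sub>E i\<in>{1..n}. carrier (H i). \<forall>y \<in> \<Pi>\<^sub>E i\<in>{1..n}. carrier (H i).
        hinner K (\<tau> x) (\<tau> y) = (\<Prod>i=1..n. hinner (H i) (x i) (y i))) \<and>
     hdense K (hspan K (\<tau> ` (\<Pi>\<^sub>E i\<in>{1..n}. carrier (H i))))"

text \<open>\<open>S 1 \<otimes> \<dots> \<otimes> S n\<close>: the bounded operator on \<open>K\<close> acting factorwise on elementary tensors.\<close>

definition tensor_op ::
    "nat \<Rightarrow> (nat \<Rightarrow> 'a hspace) \<Rightarrow> 'k hspace \<Rightarrow> ((nat \<Rightarrow> 'a) \<Rightarrow> 'k) \<Rightarrow> (nat \<Rightarrow> 'a \<Rightarrow> 'a) \<Rightarrow> 'k \<Rightarrow> 'k" where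
  "tensor_op n H K \<tau> S = (THE R. R \<in> carrier (\<B> K) \<and>
     (\<forall>x \<in> \<Pi>\<^sub>E i\<in>{1..n}. carrier (H i). R (\<tau> x) = \<tau> (\<lambda>i\<in>{1..n}. S i (x i))))"

definition ampliation ::
    "nat \<Rightarrow> (nat \<Rightarrow> 'a hspace) \<Rightarrow> 'k hspace \<Rightarrow> ((nat \<Rightarrow> 'a) \<Rightarrow> 'k) \<Rightarrow> nat \<Rightarrow> ('a \<Rightarrow> 'a) \<Rightarrow> 'k \<Rightarrow> 'k" where
  "ampliation n H K \<tau> i S = tensor_op n H K \<tau> (\<lambda>j. if j = i then S else \<one>\<^bsub>\<B> (H j)\<^esub>)"

text \<open>\<open>\<ell>\<^sup>1(n)\<close>, with coordinates indexed from 1.\<close>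

definition ell1 :: "nat \<Rightarrow> (nat \<Rightarrow> complex) set" where
  "ell1 n = {1..n} \<rightarrow>\<^sub>E UNIV"

definition ell1_norm :: "nat \<Rightarrow> (nat \<Rightarrow> complex) \<Rightarrow> real" where
  "ell1_norm n a = (\<Sum>i=1..n. cmod (a i))"

definition ell1_dist :: "nat \<Rightarrow> (nat \<Rightarrow> complex) \<Rightarrow> (nat \<Rightarrow> complex) \<Rightarrow> real" where
  "ell1_dist n a b = ell1_norm n (\<lambda>i\<in>{1..n}. a i - b i)"

definition op_dist :: "'a hspace \<Rightarrow> ('a \<Rightarrow> 'a) \<Rightarrow> ('a \<Rightarrow> 'a) \<Rightarrow> real" where
  "op_dist H R S = opnorm H (R \<ominus>\<^bsub>\<B> H\<^esub> S)"

definition isometry_into ::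
    "'a set \<Rightarrow> ('a \<Rightarrow> 'a \<Rightarrow> real) \<Rightarrow> 'b set \<Rightarrow> ('b \<Rightarrow> 'b \<Rightarrow> real) \<Rightarrow> ('a \<Rightarrow> 'b) \<Rightarrow> bool" where
  "isometry_into M d M' d' f \<longleftrightarrow> f \<in> M \<rightarrow> M' \<and> (\<forall>x\<in>M. \<forall>y\<in>M. d' (f x) (f y) = d x y)"

end

theory Submission
  imports Defs
begin

text \<open>
  Why the map is isometric: it is additive, so only the norm of \<open>a\<^sub>1 T\<^sub>1 + \<dots> + a\<^sub>n T\<^sub>n\<close> (ampliations
  understood) has to be computed. It is at most \<open>\<Sum>i. \<bar>a\<^sub>i\<bar>\<close> because each ampliation is a contraction.
  For the converse choose unimodular \<open>l\<^sub>i\<close> with \<open>a\<^sub>i l\<^sub>i = \<bar>a\<^sub>i\<bar>\<close>. By hypothesis \<open>l\<^sub>i\<close> lies in the spectrum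
  of the contraction \<open>T\<^sub>i\<close>, necessarily on its boundary, and is therefore an approximate eigenvalue, say
  with unit vector \<open>u\<^sub>i\<close> (\<open>contraction_approx_eigenvector\<close>). The unit vector \<open>u\<^sub>1 \<otimes> \<dots> \<otimes> u\<^sub>n\<close> is then an
  approximate eigenvector of every ampliation at once, with eigenvalue \<open>l\<^sub>i\<close> for the \<open>i\<close>-th, and the sum
  maps it approximately to its multiple by \<open>\<Sum>i. \<bar>a\<^sub>i\<bar>\<close> (\<open>opnorm_sum_ampliations\<close>). Placing the different
  phases in different tensor factors is what makes them independent of each other.

  The ampliation of \<open>T\<^sub>i\<close> is given only by its action on elementary tensors, so its existence has to be
  proved, together with the bound \<open>1\<close> for its norm. On the span of the elementary tensors
  the bound says that a certain Hermitian form is positive semidefinite. Its matrix is the entrywise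
  product of the Gram matrices of the other factors with the matrix
  \<open>\<langle>x\<^sub>k, x\<^sub>l\<rangle> - \<langle>T\<^sub>i x\<^sub>k, T\<^sub>i x\<^sub>l\<rangle>\<close>, and Schur's product theorem (\<open>psd_schur_product\<close>) gives positivity
  (\<open>factor_contraction_on_span\<close>). The extension to the whole Hilbert space is \<open>extend_contraction\<close>.
\<close>

section \<open>Positive semidefinite matrices\<close>

definition psd :: "'i set \<Rightarrow> ('i \<Rightarrow> 'i \<Rightarrow> complex) \<Rightarrow> bool" where
  "psd I M \<longleftrightarrow> (\<forall>k\<in>I. \<forall>l\<in>I. cnj (M k l) = M l k) \<and>
     (\<forall>c. 0 \<le> Re (\<Sum>k\<in>I. \<Sum>l\<in>I. c k * cnj (c l) * M k l))"

lemma psd_commute: "psd I M \<Longrightarrow> k \<in> I \<Longrightarrow> l \<in> I \<Longrightarrow> cnj (M k l) = M l k"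
  unfolding psd_def by blast

lemma psd_nonneg: "psd I M \<Longrightarrow> 0 \<le> Re (\<Sum>k\<in>I. \<Sum>l\<in>I. c k * cnj (c l) * M k l)"
  unfolding psd_def by blast

lemma psd_cong:
  assumes "psd I M" "\<And>k l. k \<in> I \<Longrightarrow> l \<in> I \<Longrightarrow> M k l = N k l" shows "psd I N"
  unfolding psd_def
proof (intro conjI allI ballI)
  show "cnj (N k l) = N l k" if "k \<in> I" "l \<in> I" for k l
    using psd_commute[OF assms(1) that] that by (simp add: assms(2))
  have "(\<Sum>k\<in>I. \<Sum>l\<in>I. c k * cnj (c l) * N k l) = (\<Sum>k\<in>I. \<Sum>l\<in>I. c k * cnj (c l) * M k l)" for c
    by (intro sum.cong refl) (simp add: assms(2))
  then show "0 \<le> Re (\<Sum>k\<in>I. \<Sum>l\<in>I. c k * cnj (c l) * N k l)" for c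
    using psd_nonneg[OF assms(1), of c] by simp
qed

lemma psd_subset:
  assumes "psd I M" "J \<subseteq> I" "finite I" shows "psd J M"
  unfolding psd_def
proof (intro conjI allI)
  show "\<forall>k\<in>J. \<forall>l\<in>J. cnj (M k l) = M l k"
    using assms unfolding psd_def by blast
  fix c :: "'a \<Rightarrow> complex"
  define d where "d k = (if k \<in> J then c k else 0)" for k
  have "(\<Sum>k\<in>I. \<Sum>l\<in>I. d k * cnj (d l) * M k l) = (\<Sum>k\<in>J. \<Sum>l\<in>I. d k * cnj (d l) * M k l)"
    using assms by (intro sum.mono_neutral_right) (auto simp: d_def)
  also have "\<dots> = (\<Sum>k\<in>J. \<Sum>l\<in>J. d k * cnj (d l) * M k l)"
    using assms by (intro sum.cong refl sum.mono_neutral_right) (auto simp: d_def)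
  also have "\<dots> = (\<Sum>k\<in>J. \<Sum>l\<in>J. c k * cnj (c l) * M k l)"
    by (intro sum.cong refl) (simp add: d_def)
  finally show "0 \<le> Re (\<Sum>k\<in>J. \<Sum>l\<in>J. c k * cnj (c l) * M k l)"
    using psd_nonneg[OF assms(1), of d] by simp
qed

lemma psd_ones: "psd I (\<lambda>_ _. 1)"
proof -
  have "(\<Sum>k\<in>I. \<Sum>l\<in>I. c k * cnj (c l) * 1) = of_real ((cmod (\<Sum>k\<in>I. c k))\<^sup>2)"
    for c :: "'a \<Rightarrow> complex"
    by (simp only: complex_norm_square cnj_sum sum_product mult_1_right)
  then show ?thesis
    unfolding psd_def by (simp only: Re_complex_of_real) simp
qed

lemma psd_insert_expand:
  assumes "finite I" "p \<notin> I"
  shows "(\<Sum>k\<in>insert p I. \<Sum>l\<in>insert p I. c k * cnj (c l) * M k l) =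
    c p * cnj (c p) * M p p + (\<Sum>l\<in>I. c p * cnj (c l) * M p l) + (\<Sum>k\<in>I. c k * cnj (c p) * M k p)
    + (\<Sum>k\<in>I. \<Sum>l\<in>I. c k * cnj (c l) * M k l)"
  using assms by (simp add: sum.distrib algebra_simps)

lemma psd_diag:
  assumes "psd I M" "p \<in> I" "finite I"
  shows "M p p = of_real (Re (M p p))" "0 \<le> Re (M p p)"
proof -
  show "M p p = of_real (Re (M p p))"
    using psd_commute[OF assms(1,2,2)] by (simp add: complex_eq_iff)
  have "psd {p} M" using psd_subset[OF assms(1)] assms by simp
  from psd_nonneg[OF this, of "\<lambda>_. 1"] show "0 \<le> Re (M p p)" by simp
qed

text \<open>
  Restricted to the two indices \<open>k\<close> and \<open>p\<close>, the form at the vector \<open>(1, - r * M k p)\<close> is affine in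
  \<open>r\<close> when \<open>M p p = 0\<close>, and an affine function bounded below on the whole line is constant.
\<close>

lemma psd_zero_diag:
  assumes M: "psd I M" and p: "p \<in> I" and k: "k \<in> I" and I: "finite I" and z: "M p p = 0"
  shows "M k p = 0"
proof (cases "k = p")
  case False
  have P: "psd {k, p} M" using psd_subset[OF M] assms by simp
  have sym: "M p k = cnj (M k p)" using psd_commute[OF M k p] by simp
  have key: "0 \<le> Re (M k k) - 2 * r * (cmod (M k p))\<^sup>2" for r :: real
  proof -
    have "(\<Sum>i\<in>{k,p}. \<Sum>j\<in>{k,p}. ((\<lambda>_. 1)(p := - of_real r * M k p)) i *
        cnj (((\<lambda>_. 1)(p := - of_real r * M k p)) j) * M i j)
        = M k k - 2 * of_real r * (M k p * cnj (M k p))"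
      using False z sym by (simp add: algebra_simps)
    then show ?thesis
      using psd_nonneg[OF P, of "(\<lambda>_. 1)(p := - of_real r * M k p)"]
      by (simp add: complex_norm_square[symmetric] del: complex_cnj_mult of_real_power)
  qed
  show ?thesis
  proof (rule ccontr)
    assume "M k p \<noteq> 0"
    then have pos: "(cmod (M k p))\<^sup>2 > 0" by simp
    show False
      using key[of "(Re (M k k) + 1) / (2 * (cmod (M k p))\<^sup>2)"] pos by simp
  qed
qed (use z in simp)

text \<open>
  Completing \<open>c\<close> by the value at \<open>p\<close> that minimizes the form of \<open>M\<close> turns that form into the form of
  the Schur complement at \<open>c\<close>. If \<open>M p p = 0\<close>, the convention \<open>x / 0 = 0\<close> makes the complement \<open>M\<close>
  itself and the added coordinate \<open>0\<close>, so the degenerate pivot needs no separate treatment.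
\<close>

lemma psd_schur_complement:
  assumes I: "finite I" and p: "p \<notin> I" and M: "psd (insert p I) M"
  shows "psd I (\<lambda>k l. M k l - M k p * M p l / M p p)"
  unfolding psd_def
proof (intro conjI allI ballI)
  fix k l assume "k \<in> I" "l \<in> I"
  then show "cnj (M k l - M k p * M p l / M p p) = M l k - M l p * M p k / M p p"
    using psd_commute[OF M, of k l] psd_commute[OF M, of k p] psd_commute[OF M, of p l]
      psd_commute[OF M, of p p] by simp
next
  fix c :: "'a \<Rightarrow> complex"
  define s where "s = (\<Sum>k\<in>I. c k * M k p)"
  define d where "d = c(p := - s / M p p)"
  have cs: "(\<Sum>l\<in>I. cnj (c l) * M p l) = cnj s"
    unfolding s_def cnj_sum complex_cnj_mult
    by (intro sum.cong refl) (simp add: psd_commute[OF M])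
  have dI: "d k = c k" if "k \<in> I" for k using that p by (auto simp: d_def)
  have Mpp: "cnj (M p p) = M p p" using psd_commute[OF M, of p p] by simp
  have "(\<Sum>k\<in>insert p I. \<Sum>l\<in>insert p I. d k * cnj (d l) * M k l) =
     d p * cnj (d p) * M p p + d p * (\<Sum>l\<in>I. cnj (c l) * M p l) + cnj (d p) * (\<Sum>k\<in>I. c k * M k p)
     + (\<Sum>k\<in>I. \<Sum>l\<in>I. c k * cnj (c l) * M k l)"
    unfolding psd_insert_expand[OF I p] sum_distrib_left
    by (intro arg_cong2[of _ _ _ _ "(+)"] sum.cong refl) (simp_all add: dI)
  also have "\<dots> = (\<Sum>k\<in>I. \<Sum>l\<in>I. c k * cnj (c l) * M k l) - s * cnj s / M p p"
    unfolding cs s_def[symmetric]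
    by (cases "M p p = 0") (simp_all add: d_def Mpp)
  also have "s * cnj s / M p p = (\<Sum>k\<in>I. \<Sum>l\<in>I. c k * cnj (c l) * (M k p * M p l / M p p))"
    unfolding cs[symmetric] unfolding s_def sum_product sum_divide_distrib
    by (intro sum.cong refl) (simp add: mult_ac)
  finally have "(\<Sum>k\<in>insert p I. \<Sum>l\<in>insert p I. d k * cnj (d l) * M k l) =
    (\<Sum>k\<in>I. \<Sum>l\<in>I. c k * cnj (c l) * (M k l - M k p * M p l / M p p))"
    by (simp add: sum_subtractf[symmetric] right_diff_distrib)
  then show "0 \<le> Re (\<Sum>k\<in>I. \<Sum>l\<in>I. c k * cnj (c l) * (M k l - M k p * M p l / M p p))"
    using psd_nonneg[OF M, of d] by simp
qed

text \<open>
  Cholesky factorization: each step of the induction splits off the row and column of one pivot \<open>p\<close>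
  as a rank one matrix and continues with the Schur complement.
\<close>

lemma psd_factorization:
  assumes "finite I" "psd I M"
  shows "\<exists>B. \<forall>k\<in>I. \<forall>l\<in>I. M k l = (\<Sum>m\<in>I. B m k * cnj (B m l))"
  using assms
proof (induction I arbitrary: M)
  case (insert p I)
  have fin: "finite (insert p I)" using insert by simp
  define N where "N = (\<lambda>k l. M k l - M k p * M p l / M p p)"
  have "psd I N"
    using psd_schur_complement[OF insert.hyps insert.prems] by (simp add: N_def)
  from insert.IH[OF this] obtain B where B: "\<And>k l. k \<in> I \<Longrightarrow> l \<in> I \<Longrightarrow> N k l = (\<Sum>m\<in>I. B m k * cnj (B m l))"
    by blast
  define r where "r = Re (M p p)"
  have r: "M p p = of_real r" "0 \<le> r"
    using psd_diag[OF insert.prems _ fin, of p] by (simp_all add: r_def)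
  have pp: "complex_of_real (sqrt r) * complex_of_real (sqrt r) = M p p"
    using r by (simp add: of_real_mult[symmetric])
  define C where "C m k = (if m = p then M k p / of_real (sqrt r) else if k = p then 0 else B m k)" for m k
  have "M k l = (\<Sum>m\<in>insert p I. C m k * cnj (C m l))"
    if k: "k \<in> insert p I" and l: "l \<in> insert p I" for k l
  proof -
    \<comment> \<open>The pivot term is the part removed by the Schur complement, and it equals \<open>M\<close> on row and
      column \<open>p\<close>; this is where a zero pivot has to have a zero column.\<close>
    have Cp: "C p k * cnj (C p l) = M k p * M p l / M p p"
      using psd_commute[OF insert.prems l, of p] by (simp add: C_def pp[symmetric])
    have CI: "(\<Sum>m\<in>I. C m k * cnj (C m l)) = (if k = p \<or> l = p then 0 else N k l)"
      using insert.hyps(2) k l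
      by (auto simp: C_def B intro!: sum.neutral sum.cong)
    have "M k p * M p l / M p p = M k l" if "k = p \<or> l = p"
    proof (cases "M p p = 0")
      case True
      have "M k p = 0" "M l p = 0" using psd_zero_diag[OF insert.prems _ _ fin True] k l by auto
      moreover have "M p l = cnj (M l p)" using psd_commute[OF insert.prems l, of p] by simp
      ultimately show ?thesis using that True by auto
    qed (use that in auto)
    then show ?thesis
      using insert.hyps by (simp add: Cp CI) (auto simp: N_def)
  qed
  then show ?case by blast
qed simp

text \<open>
  Schur's product theorem. Writing \<open>M\<close> as a sum of rank one matrices \<open>B m k * cnj (B m l)\<close>, the form of
  the entrywise product at \<open>c\<close> is a sum of forms of \<open>P\<close> at the rescaled vectors \<open>c k * B m k\<close>.
\<close>

lemma psd_schur_product: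
  assumes I: "finite I" and M: "psd I M" and P: "psd I P"
  shows "psd I (\<lambda>k l. M k l * P k l)"
  unfolding psd_def
proof (intro conjI allI ballI)
  fix k l assume "k \<in> I" "l \<in> I"
  then show "cnj (M k l * P k l) = M l k * P l k"
    using psd_commute[OF M, of k l] psd_commute[OF P, of k l] by simp
next
  fix c :: "'a \<Rightarrow> complex"
  obtain B where B: "\<And>k l. k \<in> I \<Longrightarrow> l \<in> I \<Longrightarrow> M k l = (\<Sum>m\<in>I. B m k * cnj (B m l))"
    using psd_factorization[OF I M] by blast
  have "(\<Sum>k\<in>I. \<Sum>l\<in>I. c k * cnj (c l) * (M k l * P k l)) =
      (\<Sum>k\<in>I. \<Sum>l\<in>I. \<Sum>m\<in>I. (c k * B m k) * cnj (c l * B m l) * P k l)"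
    by (intro sum.cong refl) (simp add: B sum_distrib_left sum_distrib_right mult_ac)
  also have "\<dots> = (\<Sum>k\<in>I. \<Sum>m\<in>I. \<Sum>l\<in>I. (c k * B m k) * cnj (c l * B m l) * P k l)"
    by (intro sum.cong refl sum.swap)
  also have "\<dots> = (\<Sum>m\<in>I. \<Sum>k\<in>I. \<Sum>l\<in>I. (c k * B m k) * cnj (c l * B m l) * P k l)"
    by (rule sum.swap)
  finally have eq: "(\<Sum>k\<in>I. \<Sum>l\<in>I. c k * cnj (c l) * (M k l * P k l)) =
      (\<Sum>m\<in>I. \<Sum>k\<in>I. \<Sum>l\<in>I. (c k * B m k) * cnj (c l * B m l) * P k l)" .
  show "0 \<le> Re (\<Sum>k\<in>I. \<Sum>l\<in>I. c k * cnj (c l) * (M k l * P k l))"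
    unfolding eq by (subst Re_sum) (rule sum_nonneg, rule psd_nonneg[OF P])
qed

lemma psd_prod:
  assumes "finite I" "finite J" "\<And>j. j \<in> J \<Longrightarrow> psd I (G j)"
  shows "psd I (\<lambda>k l. \<Prod>j\<in>J. G j k l)"
  using assms(2,3) by (induction J) (auto simp: psd_ones intro: psd_schur_product[OF assms(1)])

section \<open>Vectors and bounded operators\<close>

context complex_inner_space
begin

lemma hinner_diff_left:
  assumes "x \<in> carrier H" "y \<in> carrier H" "z \<in> carrier H"
  shows "hinner H (x \<ominus> y) z = hinner H x z - hinner H y z"
  using assms by (simp add: M.minus_eq hinner_add_left hinner_minus_left)

text \<open>
  Testing against all vectors reduces an identity between linear combinations of vectors to an
  identity of complex numbers, which the simplifier can decide; almost every vector identity below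
  is proved in this way.
\<close>

lemma hinner_ext:
  assumes x: "x \<in> carrier H" and y: "y \<in> carrier H"
    and eq: "\<And>z. z \<in> carrier H \<Longrightarrow> hinner H x z = hinner H y z"
  shows "x = y"
proof -
  have "hinner H (x \<ominus> y) (x \<ominus> y) = 0"
    using x y by (simp add: hinner_diff_left eq)
  then have "x \<ominus> y = \<zero>"
    using x y by (intro hinner_definite) auto
  then show ?thesis
    using x y M.minus_equality[of x "\<ominus> y"] by (simp add: M.minus_eq)
qed

lemmas hinner_left = hinner_add_left hinner_smult_left hinner_minus_left hinner_diff_left

lemma hnorm_smult: "x \<in> carrier H \<Longrightarrow> hnorm H (c \<odot> x) = cmod c * hnorm H x"
proof -
  assume x: "x \<in> carrier H"
  have "hinner H (c \<odot> x) (c \<odot> x) = c * cnj c * hinner H x x"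
    using x by (simp add: hinner_smult_left hinner_smult_right)
  then have "(hnorm H (c \<odot> x))\<^sup>2 = Re (c * cnj c * hinner H x x)"
    using x by (simp only: hnorm_sq smult_closed_complex)
  also have "\<dots> = Re (of_real ((cmod c)\<^sup>2) * hinner H x x)"
    by (simp only: complex_norm_square)
  also have "\<dots> = (cmod c * hnorm H x)\<^sup>2"
    using x by (simp add: power_mult_distrib hnorm_sq del: of_real_power)
  finally show ?thesis
    using x by (simp add: power2_eq_iff_nonneg hnorm_nonneg)
qed

lemma hnorm_zero [simp]: "hnorm H \<zero> = 0"
  by (simp add: hnorm_eq_0_iff)

lemma hnorm_diff_commute:
  assumes "x \<in> carrier H" "y \<in> carrier H" shows "hnorm H (x \<ominus> y) = hnorm H (y \<ominus> x)"
proof -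
  have "x \<ominus> y = \<ominus> (y \<ominus> x)"
    using assms by (intro hinner_ext) (simp_all add: hinner_left)
  then show ?thesis using assms by (simp add: hnorm_minus)
qed

lemma hnorm_triangle_diff:
  assumes "x \<in> carrier H" "y \<in> carrier H" "z \<in> carrier H"
  shows "hnorm H (x \<ominus> z) \<le> hnorm H (x \<ominus> y) + hnorm H (y \<ominus> z)"
proof -
  have "x \<ominus> z = (x \<ominus> y) \<oplus> (y \<ominus> z)"
    using assms by (intro hinner_ext) (simp_all add: hinner_left)
  then show ?thesis using assms hnorm_triangle[of "x \<ominus> y" "y \<ominus> z"] by simp
qed

lemma hnorm_le_add_diff:
  assumes "x \<in> carrier H" "y \<in> carrier H"
  shows "hnorm H x \<le> hnorm H y + hnorm H (x \<ominus> y)"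
proof -
  have "x = y \<oplus> (x \<ominus> y)"
    using assms by (intro hinner_ext) (simp_all add: hinner_left)
  then show ?thesis using assms hnorm_triangle[of y "x \<ominus> y"] by simp
qed

lemma hnorm_add_diff_add:
  assumes "x \<in> carrier H" "y \<in> carrier H" "x' \<in> carrier H" "y' \<in> carrier H"
  shows "hnorm H ((x \<oplus> y) \<ominus> (x' \<oplus> y')) \<le> hnorm H (x \<ominus> x') + hnorm H (y \<ominus> y')"
proof -
  have "(x \<oplus> y) \<ominus> (x' \<oplus> y') = (x \<ominus> x') \<oplus> (y \<ominus> y')"
    using assms by (intro hinner_ext) (simp_all add: hinner_left)
  then show ?thesis using assms hnorm_triangle[of "x \<ominus> x'" "y \<ominus> y'"] by simp
qed

lemma smult_diff_distrib:
  assumes "x \<in> carrier H" "y \<in> carrier H"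
  shows "c \<odot> x \<ominus> c \<odot> y = c \<odot> (x \<ominus> y)"
  using assms by (intro hinner_ext) (simp_all add: hinner_left right_diff_distrib)

lemma eq_if_hnorm_diff_arbitrarily_small:
  assumes x: "x \<in> carrier H" and y: "y \<in> carrier H"
    and small: "\<And>e. e > 0 \<Longrightarrow> hnorm H (x \<ominus> y) \<le> e"
  shows "x = y"
proof -
  have "hnorm H (x \<ominus> y) = 0"
  proof (rule order.antisym)
    show "hnorm H (x \<ominus> y) \<le> 0" by (rule field_le_epsilon) (simp add: small)
    show "0 \<le> hnorm H (x \<ominus> y)" using x y by (simp add: hnorm_nonneg)
  qed
  then have "x \<ominus> y = \<zero>" using x y by (simp add: hnorm_eq_0_iff)
  then have "hinner H (x \<ominus> y) z = 0" if "z \<in> carrier H" for z using that by simp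
  then show ?thesis
    using x y by (intro hinner_ext) (simp_all add: hinner_left)
qed

lemma hinner_finsum_left:
  assumes "finite A" "\<And>i. i \<in> A \<Longrightarrow> f i \<in> carrier H" "z \<in> carrier H"
  shows "hinner H (\<Oplus>i\<in>A. f i) z = (\<Sum>i\<in>A. hinner H (f i) z)"
  using assms
  by (induction A) (simp_all add: hinner_add_left Pi_def)

lemma hinner_finsum_smult:
  assumes "finite A" "\<And>i. i \<in> A \<Longrightarrow> f i \<in> carrier H"
  shows "hinner H (\<Oplus>i\<in>A. c i \<odot> f i) (\<Oplus>i\<in>A. c i \<odot> f i) =
    (\<Sum>k\<in>A. \<Sum>l\<in>A. c k * cnj (c l) * hinner H (f k) (f l))"
proof -
  let ?s = "\<Oplus>i\<in>A. c i \<odot> f i"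
  have s: "?s \<in> carrier H" using assms by (intro M.finsum_closed) auto
  have right: "hinner H x ?s = (\<Sum>l\<in>A. cnj (c l) * hinner H x (f l))" if x: "x \<in> carrier H" for x
  proof -
    have "hinner H x ?s = cnj (hinner H ?s x)" using hinner_commute[OF s x] .
    also have "\<dots> = (\<Sum>l\<in>A. cnj (c l) * cnj (hinner H (f l) x))"
      using assms x by (simp add: hinner_finsum_left hinner_smult_left)
    also have "\<dots> = (\<Sum>l\<in>A. cnj (c l) * hinner H x (f l))"
      using assms x by (intro sum.cong refl) (simp add: hinner_commute[of _ x])
    finally show ?thesis .
  qed
  have "hinner H ?s ?s = (\<Sum>k\<in>A. c k * hinner H (f k) ?s)"
    using assms s by (simp add: hinner_finsum_left hinner_smult_left)
  also have "\<dots> = (\<Sum>k\<in>A. \<Sum>l\<in>A. c k * cnj (c l) * hinner H (f k) (f l))"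
    using assms by (intro sum.cong refl) (simp add: right sum_distrib_left mult.assoc)
  finally show ?thesis .
qed

lemma psd_Gram:
  assumes "finite I" "\<And>i. i \<in> I \<Longrightarrow> x i \<in> carrier H"
  shows "psd I (\<lambda>k l. hinner H (x k) (x l))"
  unfolding psd_def
proof (intro conjI ballI allI)
  show "cnj (hinner H (x k) (x l)) = hinner H (x l) (x k)" if "k \<in> I" "l \<in> I" for k l
    using that assms by (simp add: hinner_commute[of "x k" "x l"])
  have "(\<Oplus>i\<in>I. c i \<odot> x i) \<in> carrier H" for c using assms by (intro M.finsum_closed) auto
  then show "0 \<le> Re (\<Sum>k\<in>I. \<Sum>l\<in>I. c k * cnj (c l) * hinner H (x k) (x l))" for c
    using hinner_nonneg[of "\<Oplus>i\<in>I. c i \<odot> x i"] hinner_finsum_smult[of I x c] assms by simp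
qed

lemma limit_exists_if_mcomplete:
  fixes s :: "nat \<Rightarrow> 'a"
  assumes "Metric_space.mcomplete (carrier H) (hdist H)"
    and s: "\<And>n. s n \<in> carrier H"
    and C: "\<And>e. e > 0 \<Longrightarrow> \<exists>N. \<forall>m\<ge>N. \<forall>n\<ge>N. hnorm H (s m \<ominus> s n) < e"
  obtains l where "l \<in> carrier H" "\<And>e. e > 0 \<Longrightarrow> \<exists>N. \<forall>n\<ge>N. hnorm H (s n \<ominus> l) < e"
proof -
  interpret MS: Metric_space "carrier H" "hdist H" by (rule Metric_space_hdist)
  have "MS.MCauchy s"
    unfolding MS.MCauchy_def using s C by (auto simp: hdist_def)
  then obtain l where "limitin MS.mtopology s l sequentially"
    using assms(1) unfolding MS.mcomplete_def by blast
  then have l: "l \<in> carrier H" "\<And>e. e > 0 \<Longrightarrow> \<exists>N. \<forall>n\<ge>N. hdist H (s n) l < e"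
    unfolding MS.limit_metric_sequentially by blast+
  then show ?thesis using that[of l] s by (simp add: hdist_def)
qed

lemma hdense_approx:
  assumes "hdense H S" "S \<subseteq> carrier H" "v \<in> carrier H" "e > 0"
  obtains p where "p \<in> S" "hnorm H (p \<ominus> v) < e"
proof -
  interpret MS: Metric_space "carrier H" "hdist H" by (rule Metric_space_hdist)
  obtain p where "p \<in> S" "p \<in> MS.mball v e"
    using assms unfolding hdense_def MS.metric_closure_of by blast
  then show ?thesis using that[of p] assms by (auto simp: hdist_def hnorm_diff_commute)
qed


lemma bounded_operator_add:
  "S \<in> bounded_operators H \<Longrightarrow> x \<in> carrier H \<Longrightarrow> y \<in> carrier H \<Longrightarrow> S (x \<oplus> y) = S x \<oplus> S y"
  unfolding bounded_operators_def by blast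

lemma bounded_operator_smult:
  "S \<in> bounded_operators H \<Longrightarrow> x \<in> carrier H \<Longrightarrow> S (c \<odot> x) = c \<odot> S x"
  unfolding bounded_operators_def by blast

lemma bounded_operator_closed:
  "S \<in> bounded_operators H \<Longrightarrow> x \<in> carrier H \<Longrightarrow> S x \<in> carrier H"
  unfolding bounded_operators_def by auto

lemma bounded_operator_ext:
  assumes "R \<in> bounded_operators H" "S \<in> bounded_operators H"
    and "\<And>x. x \<in> carrier H \<Longrightarrow> R x = S x"
  shows "R = S"
  using assms unfolding bounded_operators_def by (blast intro: PiE_ext)

lemma bounded_operatorI:
  assumes "S \<in> carrier H \<rightarrow>\<^sub>E carrier H"
    and "\<And>x y. x \<in> carrier H \<Longrightarrow> y \<in> carrier H \<Longrightarrow> S (x \<oplus> y) = S x \<oplus> S y"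
    and "\<And>c x. x \<in> carrier H \<Longrightarrow> S (c \<odot> x) = c \<odot> S x"
    and "\<And>x. x \<in> carrier H \<Longrightarrow> hnorm H (S x) \<le> C * hnorm H x"
  shows "S \<in> bounded_operators H"
  unfolding bounded_operators_def
  by (intro CollectI conjI ballI allI exI[of _ C] assms)

text \<open>
  Nonnegativity of the constant is not automatic: on the zero space a negative one also bounds
  every operator.
\<close>

lemma bounded_operator_bound:
  assumes "S \<in> bounded_operators H"
  obtains C where "C \<ge> 0" "\<And>x. x \<in> carrier H \<Longrightarrow> hnorm H (S x) \<le> C * hnorm H x"
proof -
  obtain C where C: "\<forall>x\<in>carrier H. hnorm H (S x) \<le> C * hnorm H x"
    using assms unfolding bounded_operators_def by blast
  have "hnorm H (S x) \<le> \<bar>C\<bar> * hnorm H x" if "x \<in> carrier H" for x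
    using C that mult_right_mono[OF abs_ge_self[of C] hnorm_nonneg[OF that]]
    by (meson order.trans)
  then show ?thesis using that[of "\<bar>C\<bar>"] by simp
qed

lemma bounded_operator_diff:
  assumes "S \<in> bounded_operators H" "x \<in> carrier H" "y \<in> carrier H"
  shows "S (x \<ominus> y) = S x \<ominus> S y"
  using assms
  by (simp add: M.minus_eq a_inv_eq_smult bounded_operator_add bounded_operator_smult
      bounded_operator_closed)

lemma bounded_operator_zero:
  assumes "S \<in> bounded_operators H" shows "S \<zero> = \<zero>"
proof -
  have "S (0 \<odot> \<zero>) = 0 \<odot> S \<zero>" using assms by (simp add: bounded_operator_smult)
  moreover have "0 \<odot> x = \<zero>" if "x \<in> carrier H" for x
    using that by (intro hinner_ext) (simp_all add: hinner_left)
  ultimately show ?thesis using bounded_operator_closed[OF assms] by simp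
qed

lemma bounded_operator_finsum:
  assumes S: "S \<in> bounded_operators H"
    and "finite A" "\<And>i. i \<in> A \<Longrightarrow> f i \<in> carrier H"
  shows "S (\<Oplus>i\<in>A. f i) = (\<Oplus>i\<in>A. S (f i))"
  using assms(2,3)
  by (induction A)
     (simp_all add: bounded_operator_zero[OF S] bounded_operator_add[OF S]
        bounded_operator_closed[OF S] Pi_def)

lemma carrier_B [simp]: "carrier (\<B> H) = bounded_operators H"
  by (simp add: \<B>_def)

lemma add_B_apply: "x \<in> carrier H \<Longrightarrow> (R \<oplus>\<^bsub>\<B> H\<^esub> S) x = R x \<oplus> S x"
  by (simp add: \<B>_def)

lemma smult_B_apply: "x \<in> carrier H \<Longrightarrow> (c \<odot>\<^bsub>\<B> H\<^esub> S) x = c \<odot> S x"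
  by (simp add: \<B>_def)

lemma zero_B_apply: "x \<in> carrier H \<Longrightarrow> \<zero>\<^bsub>\<B> H\<^esub> x = \<zero>"
  by (simp add: \<B>_def)

lemma one_B_apply: "x \<in> carrier H \<Longrightarrow> \<one>\<^bsub>\<B> H\<^esub> x = x"
  by (simp add: \<B>_def)

lemma smult_zero_complex: "c \<odot> \<zero> = \<zero>"
  by (intro hinner_ext) (simp_all add: hinner_left)

lemma zero_B_closed: "\<zero>\<^bsub>\<B> H\<^esub> \<in> bounded_operators H"
  by (rule bounded_operatorI[of _ 0])
     (auto simp: \<B>_def smult_zero_complex)

lemma one_B_closed: "\<one>\<^bsub>\<B> H\<^esub> \<in> bounded_operators H"
  by (rule bounded_operatorI[of _ 1]) (auto simp: \<B>_def)

lemma add_B_closed: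
  assumes R: "R \<in> bounded_operators H" and S: "S \<in> bounded_operators H"
  shows "R \<oplus>\<^bsub>\<B> H\<^esub> S \<in> bounded_operators H"
proof -
  obtain C D where C: "\<And>x. x \<in> carrier H \<Longrightarrow> hnorm H (R x) \<le> C * hnorm H x"
    and D: "\<And>x. x \<in> carrier H \<Longrightarrow> hnorm H (S x) \<le> D * hnorm H x"
    using bounded_operator_bound[OF R] bounded_operator_bound[OF S] by metis
  note cl = bounded_operator_closed[OF R] bounded_operator_closed[OF S]
  show ?thesis
  proof (rule bounded_operatorI[of _ "C + D"])
    show "R \<oplus>\<^bsub>\<B> H\<^esub> S \<in> carrier H \<rightarrow>\<^sub>E carrier H" by (auto simp: \<B>_def cl)
    show "(R \<oplus>\<^bsub>\<B> H\<^esub> S) (x \<oplus> y) = (R \<oplus>\<^bsub>\<B> H\<^esub> S) x \<oplus> (R \<oplus>\<^bsub>\<B> H\<^esub> S) y"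
      if "x \<in> carrier H" "y \<in> carrier H" for x y
      using that by (simp add: add_B_apply bounded_operator_add R S cl M.a_ac)
    show "(R \<oplus>\<^bsub>\<B> H\<^esub> S) (c \<odot> x) = c \<odot> (R \<oplus>\<^bsub>\<B> H\<^esub> S) x" if "x \<in> carrier H" for c x
      using that by (intro hinner_ext)
        (simp_all add: add_B_apply bounded_operator_smult R S cl hinner_left distrib_left)
    show "hnorm H ((R \<oplus>\<^bsub>\<B> H\<^esub> S) x) \<le> (C + D) * hnorm H x" if "x \<in> carrier H" for x
      using hnorm_triangle[of "R x" "S x"] C[of x] D[of x] that
      by (simp add: add_B_apply cl distrib_right)
  qed
qed

lemma smult_B_closed:
  assumes S: "S \<in> bounded_operators H"
  shows "c \<odot>\<^bsub>\<B> H\<^esub> S \<in> bounded_operators H"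
proof -
  obtain D where D: "\<And>x. x \<in> carrier H \<Longrightarrow> hnorm H (S x) \<le> D * hnorm H x"
    using bounded_operator_bound[OF S] by metis
  note cl = bounded_operator_closed[OF S]
  show ?thesis
  proof (rule bounded_operatorI[of _ "cmod c * D"])
    show "c \<odot>\<^bsub>\<B> H\<^esub> S \<in> carrier H \<rightarrow>\<^sub>E carrier H" by (auto simp: \<B>_def cl)
    show "(c \<odot>\<^bsub>\<B> H\<^esub> S) (x \<oplus> y) = (c \<odot>\<^bsub>\<B> H\<^esub> S) x \<oplus> (c \<odot>\<^bsub>\<B> H\<^esub> S) y"
      if "x \<in> carrier H" "y \<in> carrier H" for x y
      using that by (intro hinner_ext)
        (simp_all add: smult_B_apply bounded_operator_add S cl hinner_left distrib_left)
    show "(c \<odot>\<^bsub>\<B> H\<^esub> S) (d \<odot> x) = d \<odot> (c \<odot>\<^bsub>\<B> H\<^esub> S) x" if "x \<in> carrier H" for d x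
      using that by (intro hinner_ext)
        (simp_all add: smult_B_apply bounded_operator_smult S cl hinner_left)
    show "hnorm H ((c \<odot>\<^bsub>\<B> H\<^esub> S) x) \<le> cmod c * D * hnorm H x" if "x \<in> carrier H" for x
      using mult_left_mono[OF D[OF that], of "cmod c"] that
      by (simp add: smult_B_apply cl hnorm_smult mult.assoc)
  qed
qed

lemma module_B: "module complex_field (\<B> H)"
proof (rule moduleI)
  show "cring complex_field" by (rule cring_from_type_algebra)
  note closed = bounded_operator_closed add_B_closed smult_B_closed zero_B_closed one_B_closed
  note evals = add_B_apply smult_B_apply zero_B_apply one_B_apply
  show "abelian_group (\<B> H)"
  proof (rule abelian_groupI)
    show "\<exists>S\<in>carrier (\<B> H). S \<oplus>\<^bsub>\<B> H\<^esub> R = \<zero>\<^bsub>\<B> H\<^esub>" if "R \<in> carrier (\<B> H)" for R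
    proof
      show "(-1) \<odot>\<^bsub>\<B> H\<^esub> R \<in> carrier (\<B> H)" using that by (simp add: closed)
      show "(-1) \<odot>\<^bsub>\<B> H\<^esub> R \<oplus>\<^bsub>\<B> H\<^esub> R = \<zero>\<^bsub>\<B> H\<^esub>"
        using that
        by (intro bounded_operator_ext hinner_ext) (simp_all add: evals closed hinner_left)
    qed
  qed (auto intro!: bounded_operator_ext hinner_ext simp: evals closed hinner_left)
qed (auto intro!: bounded_operator_ext hinner_ext
      simp: add_B_apply smult_B_apply bounded_operator_closed add_B_closed smult_B_closed
        hinner_left ring_of_type_algebra_def algebra_simps)

lemma diff_B:
  assumes R: "R \<in> bounded_operators H" and S: "S \<in> bounded_operators H"
  shows "R \<ominus>\<^bsub>\<B> H\<^esub> S \<in> bounded_operators H"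
    and "x \<in> carrier H \<Longrightarrow> (R \<ominus>\<^bsub>\<B> H\<^esub> S) x = R x \<ominus> S x"
proof -
  interpret B: module complex_field "\<B> H" by (rule module_B)
  have n: "\<ominus>\<^bsub>\<B> H\<^esub> S \<in> bounded_operators H"
    using B.M.a_inv_closed[of S] S by simp
  then show "R \<ominus>\<^bsub>\<B> H\<^esub> S \<in> bounded_operators H"
    using R by (simp add: B.M.minus_eq add_B_closed)
  assume x: "x \<in> carrier H"
  have "S \<oplus>\<^bsub>\<B> H\<^esub> (\<ominus>\<^bsub>\<B> H\<^esub> S) = \<zero>\<^bsub>\<B> H\<^esub>"
    using S by (intro B.M.r_neg) simp
  then have "S x \<oplus> (\<ominus>\<^bsub>\<B> H\<^esub> S) x = \<zero>"
    using x by (metis add_B_apply zero_B_apply)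
  then have "(\<ominus>\<^bsub>\<B> H\<^esub> S) x = \<ominus> S x"
    using x S n by (metis M.add.inv_comm M.minus_equality bounded_operator_closed M.a_comm)
  then show "(R \<ominus>\<^bsub>\<B> H\<^esub> S) x = R x \<ominus> S x"
    using x by (simp add: B.M.minus_eq M.minus_eq add_B_apply)
qed

lemma opnorm_bdd_above:
  assumes "S \<in> bounded_operators H"
  shows "bdd_above ((\<lambda>x. hnorm H (S x)) ` {x \<in> carrier H. hnorm H x \<le> 1})"
proof -
  obtain C where C: "C \<ge> 0" "\<And>x. x \<in> carrier H \<Longrightarrow> hnorm H (S x) \<le> C * hnorm H x"
    using bounded_operator_bound[OF assms] by blast
  have "hnorm H (S x) \<le> C" if "x \<in> carrier H" "hnorm H x \<le> 1" for x
    using C(2)[OF that(1)] mult_left_mono[OF that(2) C(1)] by simp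
  then show ?thesis by (auto intro!: bdd_aboveI[of _ C])
qed

lemma opnorm_le:
  assumes "C \<ge> 0" "\<And>x. x \<in> carrier H \<Longrightarrow> hnorm H (S x) \<le> C * hnorm H x"
  shows "opnorm H S \<le> C"
  unfolding opnorm_def
proof (rule cSUP_least)
  show "{x \<in> carrier H. hnorm H x \<le> 1} \<noteq> {}"
    by (auto intro!: exI[of _ "\<zero>"])
  show "hnorm H (S x) \<le> C" if "x \<in> {x \<in> carrier H. hnorm H x \<le> 1}" for x
    using assms(2)[of x] mult_left_mono[of "hnorm H x" 1 C] assms(1) that by auto
qed

lemma hnorm_le_opnorm:
  assumes "S \<in> bounded_operators H" "x \<in> carrier H" "hnorm H x \<le> 1"
  shows "hnorm H (S x) \<le> opnorm H S"
  unfolding opnorm_def using assms by (intro cSUP_upper opnorm_bdd_above) auto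

lemma contraction_hnorm_le:
  assumes "contraction H S" "x \<in> carrier H"
  shows "hnorm H (S x) \<le> hnorm H x"
proof (cases "x = \<zero>")
  case True
  then show ?thesis using assms bounded_operator_zero[of S] by (simp add: contraction_def)
next
  case False
  have S: "S \<in> bounded_operators H" "opnorm H S \<le> 1" using assms by (simp_all add: contraction_def)
  have pos: "hnorm H x > 0"
    using False assms hnorm_nonneg[of x] hnorm_eq_0_iff[of x] by fastforce
  define y where "y = complex_of_real (1 / hnorm H x) \<odot> x"
  have y: "y \<in> carrier H" "hnorm H y = 1"
    using assms(2) pos by (simp_all add: y_def hnorm_smult norm_divide)
  have "hnorm H (S y) = hnorm H (S x) / hnorm H x"
    using assms(2) pos S by (simp add: y_def bounded_operator_smult hnorm_smult
        bounded_operator_closed norm_divide)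
  then have "hnorm H (S x) / hnorm H x \<le> 1"
    using hnorm_le_opnorm[OF S(1) y(1)] y(2) S(2) by simp
  then show ?thesis using pos by (simp add: pos_divide_le_eq)
qed

end

section \<open>Approximate eigenvectors\<close>

context complex_inner_space
begin

text \<open>
  The lower bound gives injectivity and is at the same time the boundedness of the inverse.
\<close>

lemma bounded_below_surj_imp_Unit:
  assumes A: "A \<in> bounded_operators H" and d: "d > 0"
    and below: "\<And>x. x \<in> carrier H \<Longrightarrow> d * hnorm H x \<le> hnorm H (A x)"
    and surj: "A ` carrier H = carrier H"
  shows "A \<in> Units (\<B> H)"
proof -
  note cl = bounded_operator_closed[OF A]
  have inj: "inj_on A (carrier H)"
  proof (rule inj_onI)
    fix x y assume x: "x \<in> carrier H" and y: "y \<in> carrier H" and eq: "A x = A y"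
    have "A (x \<ominus> y) = \<zero>"
      unfolding bounded_operator_diff[OF A x y] eq using cl[OF y] by (simp add: M.minus_eq M.r_neg)
    then have "d * hnorm H (x \<ominus> y) \<le> 0"
      using below[of "x \<ominus> y"] x y by simp
    then have "hnorm H (x \<ominus> y) \<le> 0"
      using d by (simp add: mult_le_0_iff)
    then show "x = y"
      using x y by (intro eq_if_hnorm_diff_arbitrarily_small) auto
  qed
  define S where "S = (\<lambda>y\<in>carrier H. inv_into (carrier H) A y)"
  have SA: "S (A x) = x" if "x \<in> carrier H" for x
    using that inj cl by (simp add: S_def)
  have Scl: "S y \<in> carrier H" and AS: "A (S y) = y" if "y \<in> carrier H" for y
    using that surj by (auto simp: S_def inv_into_into f_inv_into_f)
  have S: "S \<in> bounded_operators H"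
  proof (rule bounded_operatorI[of _ "1 / d"])
    show "S \<in> carrier H \<rightarrow>\<^sub>E carrier H" using Scl by (auto simp: S_def)
    show "S (x \<oplus> y) = S x \<oplus> S y" if "x \<in> carrier H" "y \<in> carrier H" for x y
      using SA[of "S x \<oplus> S y"] that by (simp add: bounded_operator_add[OF A] Scl AS)
    show "S (c \<odot> x) = c \<odot> S x" if "x \<in> carrier H" for c x
      using SA[of "c \<odot> S x"] that by (simp add: bounded_operator_smult[OF A] Scl AS)
    show "hnorm H (S x) \<le> 1 / d * hnorm H x" if "x \<in> carrier H" for x
      using below[of "S x"] that d by (simp add: Scl AS pos_le_divide_eq mult.commute)
  qed
  have "A \<otimes>\<^bsub>\<B> H\<^esub> S = \<one>\<^bsub>\<B> H\<^esub>" "S \<otimes>\<^bsub>\<B> H\<^esub> A = \<one>\<^bsub>\<B> H\<^esub>"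
    by (auto simp: \<B>_def compose_def AS SA intro!: restrict_ext)
  then show ?thesis
    unfolding Units_def using A S by auto
qed

end

context complex_hilbert_space
begin

text \<open>
  Stability of invertibility under perturbations smaller than the lower bound of the operator. It
  replaces the Neumann series for the inverse by a fixed point argument in the space itself.
\<close>

lemma surj_perturbation:
  assumes A: "A \<in> bounded_operators H" and B: "B \<in> bounded_operators H"
    and d: "d > 0"
    and below: "\<And>x. x \<in> carrier H \<Longrightarrow> d * hnorm H x \<le> hnorm H (B x)"
    and surj: "B ` carrier H = carrier H"
    and q: "q < 1"
    and close: "\<And>x. x \<in> carrier H \<Longrightarrow> hnorm H (A x \<ominus> B x) \<le> q * d * hnorm H x"
  shows "A ` carrier H = carrier H"
proof (intro equalityI subsetI)
  note cl = bounded_operator_closed[OF A] bounded_operator_closed[OF B]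
  fix y assume y: "y \<in> carrier H"
  define R where "R = inv_into (carrier H) B"
  have R: "R z \<in> carrier H" "B (R z) = z" if "z \<in> carrier H" for z
    using that surj by (simp_all add: R_def inv_into_into f_inv_into_f)
  \<comment> \<open>\<open>A x = y\<close> says that \<open>x\<close> is fixed by \<open>B\<^sup>-\<^sup>1 (y - (A - B) x)\<close>, a contraction in \<open>x\<close>.\<close>
  define f where "f x = R (y \<ominus> (A x \<ominus> B x))" for x
  have f: "f x \<in> carrier H" "B (f x) = y \<ominus> (A x \<ominus> B x)" if "x \<in> carrier H" for x
    using that R y cl by (simp_all add: f_def)
  interpret MS: Metric_space "carrier H" "hdist H" by (rule Metric_space_hdist)
  obtain x where x: "x \<in> carrier H" "f x = x"
  proof (rule MS.Banach_fixedpoint_thm[OF complete _ _ q])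
    show "carrier H \<noteq> {}" using y by blast
    show "f \<in> carrier H \<rightarrow> carrier H" using f by blast
    show "hdist H (f x) (f x') \<le> q * hdist H x x'" if x: "x \<in> carrier H" "x' \<in> carrier H" for x x'
    proof -
      have "B (f x \<ominus> f x') = \<ominus> (A (x \<ominus> x') \<ominus> B (x \<ominus> x'))"
        using x f y cl
        by (intro hinner_ext)
           (simp_all add: bounded_operator_diff[OF A] bounded_operator_diff[OF B] hinner_left)
      then have "hnorm H (B (f x \<ominus> f x')) \<le> q * d * hnorm H (x \<ominus> x')"
        using close[of "x \<ominus> x'"] x cl by (simp add: hnorm_minus)
      then have "d * hnorm H (f x \<ominus> f x') \<le> d * (q * hnorm H (x \<ominus> x'))"
        using below[of "f x \<ominus> f x'"] f x by (simp add: mult_ac)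
      then show ?thesis using d x f by (simp add: hdist_def)
    qed
  qed blast
  have "B x = y \<ominus> (A x \<ominus> B x)" using f[OF x(1)] x by simp
  then have *: "hinner H (B x) z = hinner H (y \<ominus> (A x \<ominus> B x)) z" for z by simp
  have "A x = y"
  proof (rule hinner_ext)
    show "hinner H (A x) z = hinner H y z" if "z \<in> carrier H" for z
      using *[of z] x y cl that by (simp add: hinner_left)
  qed (use x y cl in auto)
  then show "y \<in> A ` carrier H" using x by blast
qed (use bounded_operator_closed[OF A] in blast)

text \<open>
  Every unimodular spectral point of a contraction is an approximate eigenvalue, because it lies on
  the boundary of the spectrum. Suppose \<open>T - l\<close> is bounded below by \<open>e\<close>. For \<open>m\<close> slightly outside the
  unit disc, in the direction of \<open>l\<close>, the operator \<open>T - m\<close> differs from \<open>- m\<close> by less than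
  \<open>\<bar>m\<bar>\<close> and hence is onto; it inherits most of the lower bound \<open>e\<close>, and \<open>T - l\<close> is in turn a small perturbation of
  \<open>T - m\<close>. So \<open>T - l\<close> is invertible, and \<open>l\<close> is not in the spectrum.
\<close>

lemma contraction_approx_eigenvector:
  assumes T: "contraction H T" and l: "cmod l = 1" "l \<in> spectrum H T" and e: "e > 0"
  obtains x where "x \<in> carrier H" "hnorm H x = 1" "hnorm H (T x \<ominus> l \<odot> x) < e"
proof (rule ccontr)
  assume contra: "\<not> thesis"
  note witness = that
  have none: "e \<le> hnorm H (T y \<ominus> l \<odot> y)" if "y \<in> carrier H" "hnorm H y = 1" for y
    using witness[OF that] contra by force
  have Tb: "T \<in> bounded_operators H" using T by (simp add: contraction_def)
  note cl = bounded_operator_closed[OF Tb]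
  define A where "A m = T \<ominus>\<^bsub>\<B> H\<^esub> m \<odot>\<^bsub>\<B> H\<^esub> \<one>\<^bsub>\<B> H\<^esub>" for m
  have mb: "m \<odot>\<^bsub>\<B> H\<^esub> \<one>\<^bsub>\<B> H\<^esub> \<in> bounded_operators H" for m
    by (intro smult_B_closed one_B_closed)
  have Ab: "A m \<in> bounded_operators H" for m
    unfolding A_def by (intro diff_B Tb mb)
  have Ax: "A m x = T x \<ominus> m \<odot> x" if "x \<in> carrier H" for m x
    using that unfolding A_def by (simp add: diff_B(2)[OF Tb mb] smult_B_apply one_B_apply)
  have below: "e * hnorm H x \<le> hnorm H (A l x)" if x: "x \<in> carrier H" for x
  proof (cases "x = \<zero>")
    case True
    then show ?thesis using bounded_operator_zero[OF Ab] by simp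
  next
    case False
    have pos: "hnorm H x > 0"
      using False x hnorm_nonneg[of x] hnorm_eq_0_iff[of x] by fastforce
    define y where "y = complex_of_real (1 / hnorm H x) \<odot> x"
    have y: "y \<in> carrier H" "hnorm H y = 1"
      using x pos by (simp_all add: y_def hnorm_smult norm_divide)
    have "e \<le> hnorm H (A l y)" using none[OF y] y by (simp add: Ax)
    also have "A l y = complex_of_real (1 / hnorm H x) \<odot> A l x"
      using x unfolding y_def by (rule bounded_operator_smult[OF Ab])
    finally show ?thesis
      using pos x bounded_operator_closed[OF Ab x]
      by (simp add: hnorm_smult norm_divide pos_le_divide_eq)
  qed
  \<comment> \<open>With \<open>m\<close> at distance \<open>t = e / 4\<close> from \<open>l\<close>, the operator \<open>T - m\<close> is bounded below by \<open>3 * t\<close>, and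
    the second perturbation has relative size \<open>1 / 3\<close>.\<close>
  define t where "t = e / 4"
  have t: "t > 0" "e = 4 * t" using e by (simp_all add: t_def)
  define m where "m = complex_of_real (1 + t) * l"
  have m: "cmod m = 1 + t" "m \<noteq> 0" "cmod (m - l) = t"
  proof -
    show m: "cmod m = 1 + t" using l t by (simp add: m_def norm_mult del: of_real_add)
    show "m \<noteq> 0" using m t by auto
    have "m - l = of_real t * l" by (simp add: m_def algebra_simps)
    then show "cmod (m - l) = t" using l t by (simp add: norm_mult)
  qed
  have surj_m: "A m ` carrier H = carrier H"
  proof (rule surj_perturbation[OF Ab, of "(-m) \<odot>\<^bsub>\<B> H\<^esub> \<one>\<^bsub>\<B> H\<^esub>" "1 + t" "1 / (1 + t)"])
    show "(-m) \<odot>\<^bsub>\<B> H\<^esub> \<one>\<^bsub>\<B> H\<^esub> \<in> bounded_operators H" by (rule mb)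
    show "(1 + t) * hnorm H x \<le> hnorm H (((-m) \<odot>\<^bsub>\<B> H\<^esub> \<one>\<^bsub>\<B> H\<^esub>) x)" if "x \<in> carrier H" for x
      using that m by (simp add: smult_B_apply one_B_apply hnorm_smult)
    show "((-m) \<odot>\<^bsub>\<B> H\<^esub> \<one>\<^bsub>\<B> H\<^esub>) ` carrier H = carrier H"
    proof (intro equalityI subsetI)
      fix y assume y: "y \<in> carrier H"
      have "((-m) \<odot>\<^bsub>\<B> H\<^esub> \<one>\<^bsub>\<B> H\<^esub>) ((- 1 / m) \<odot> y) = y"
        using y m by (intro hinner_ext) (simp_all add: smult_B_apply one_B_apply hinner_left)
      then show "y \<in> ((-m) \<odot>\<^bsub>\<B> H\<^esub> \<one>\<^bsub>\<B> H\<^esub>) ` carrier H"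
        using y by (metis image_eqI smult_closed_complex)
    qed (use bounded_operator_closed[OF mb] in blast)
    show "hnorm H (A m x \<ominus> ((-m) \<odot>\<^bsub>\<B> H\<^esub> \<one>\<^bsub>\<B> H\<^esub>) x) \<le> 1 / (1 + t) * (1 + t) * hnorm H x"
      if x: "x \<in> carrier H" for x
    proof -
      have "A m x \<ominus> ((-m) \<odot>\<^bsub>\<B> H\<^esub> \<one>\<^bsub>\<B> H\<^esub>) x = T x"
        using x cl by (intro hinner_ext) (simp_all add: Ax smult_B_apply one_B_apply hinner_left)
      then show ?thesis using contraction_hnorm_le[OF T x] t by simp
    qed
  qed (use t in simp_all)
  have diff: "hnorm H (A l x \<ominus> A m x) = t * hnorm H x" if x: "x \<in> carrier H" for x
  proof -
    have "A l x \<ominus> A m x = (m - l) \<odot> x"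
      using x cl by (intro hinner_ext) (simp_all add: Ax hinner_left algebra_simps)
    then show ?thesis using x m by (simp add: hnorm_smult)
  qed
  have "A l ` carrier H = carrier H"
  proof (rule surj_perturbation[OF Ab Ab _ _ surj_m])
    show "3 * t * hnorm H x \<le> hnorm H (A m x)" if x: "x \<in> carrier H" for x
      using below[OF x] diff[OF x] hnorm_le_add_diff[of "A l x" "A m x"]
        bounded_operator_closed[OF Ab x] t by simp
    show "hnorm H (A l x \<ominus> A m x) \<le> 1 / 3 * (3 * t) * hnorm H x" if x: "x \<in> carrier H" for x
      using diff[OF x] by simp
  qed (use t in simp_all)
  then have "A l \<in> Units (\<B> H)"
    using below e by (intro bounded_below_surj_imp_Unit[OF Ab])
  then show False using l by (simp add: spectrum_def A_def)
qed

section \<open>Operators determined on a dense subspace\<close>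

text \<open>
  An assignment \<open>e x \<mapsto> g x\<close> that does not increase the norm of any linear combination extends to a
  contraction when the \<open>e x\<close> span a dense subspace. The pairs of corresponding linear combinations
  form a linear relation \<open>G\<close> that is contractive, hence single-valued; it is never treated as a
  function on the span, and the operator is obtained directly as the closure of \<open>G\<close>. The families
  in the hypothesis are indexed by numbers, with repetitions permitted, so that different \<open>x\<close> with
  the same \<open>e x\<close> are covered.
\<close>

lemma extend_contraction:
  fixes e g :: "'x \<Rightarrow> 'a"
  assumes e: "\<And>x. x \<in> J \<Longrightarrow> e x \<in> carrier H" and g: "\<And>x. x \<in> J \<Longrightarrow> g x \<in> carrier H"
    and dense: "hdense H (hspan H (e ` J))"
    and contr: "\<And>(m::nat) c x. (\<And>k. k < m \<Longrightarrow> x k \<in> J) \<Longrightarrow>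
      hnorm H (\<Oplus>k\<in>{..<m}. c k \<odot> g (x k)) \<le> hnorm H (\<Oplus>k\<in>{..<m}. c k \<odot> e (x k))"
  obtains R where "R \<in> bounded_operators H" "\<And>x. x \<in> J \<Longrightarrow> R (e x) = g x"
    "\<And>v. v \<in> carrier H \<Longrightarrow> hnorm H (R v) \<le> hnorm H v"
proof -
  have e_all: "\<forall>x\<in>J. e x \<in> carrier H" and g_all: "\<forall>x\<in>J. g x \<in> carrier H"
    using e g by blast+
  define G where "G = {(p, q). \<exists>(m::nat) c x. (\<forall>k<m. x k \<in> J) \<and>
      p = (\<Oplus>k\<in>{..<m}. c k \<odot> e (x k)) \<and> q = (\<Oplus>k\<in>{..<m}. c k \<odot> g (x k))}"
  have GI: "((\<Oplus>k\<in>{..<m}. c k \<odot> e (x k)), (\<Oplus>k\<in>{..<m}. c k \<odot> g (x k))) \<in> G"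
    if "\<And>k. k < m \<Longrightarrow> x k \<in> J" for m :: nat and c x
    using that unfolding G_def by blast
  have Gcl: "p \<in> carrier H" "q \<in> carrier H" if "(p, q) \<in> G" for p q
    using that e g unfolding G_def by (auto intro!: M.finsum_closed)
  have Gnorm: "hnorm H q \<le> hnorm H p" if "(p, q) \<in> G" for p q
    using that contr unfolding G_def by blast
  have G0: "(\<zero>, \<zero>) \<in> G" using GI[of 0] by simp
  have Gsnoc: "(p \<oplus> a \<odot> e y, q \<oplus> a \<odot> g y) \<in> G" if pq: "(p, q) \<in> G" and y: "y \<in> J" for p q a y
  proof -
    obtain m :: nat and c x where x: "\<forall>k<m. x k \<in> J"
      and p: "p = (\<Oplus>k\<in>{..<m}. c k \<odot> e (x k))" and q: "q = (\<Oplus>k\<in>{..<m}. c k \<odot> g (x k))"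
      using pq by (auto simp: G_def)
    have snoc: "(\<Oplus>k\<in>{..<Suc m}. (c(m := a)) k \<odot> h ((x(m := y)) k)) =
      (\<Oplus>k\<in>{..<m}. c k \<odot> h (x k)) \<oplus> a \<odot> h y" if h: "\<forall>x\<in>J. h x \<in> carrier H" for h
    proof -
      have "(\<Oplus>k\<in>{..<m}. (c(m := a)) k \<odot> h ((x(m := y)) k)) = (\<Oplus>k\<in>{..<m}. c k \<odot> h (x k))"
        using x h by (intro M.finsum_cong') auto
      moreover have "(\<Oplus>k\<in>{..<m}. c k \<odot> h (x k)) \<in> carrier H"
        using x h by (intro M.finsum_closed) auto
      ultimately show ?thesis
        unfolding lessThan_Suc using x h y
        by (subst M.finsum_insert) (auto simp: M.a_comm)
    qed
    have "((\<Oplus>k\<in>{..<Suc m}. (c(m := a)) k \<odot> e ((x(m := y)) k)),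
        (\<Oplus>k\<in>{..<Suc m}. (c(m := a)) k \<odot> g ((x(m := y)) k))) \<in> G"
      using x y by (intro GI) (auto simp: less_Suc_eq)
    then show ?thesis
      unfolding snoc[OF e_all] snoc[OF g_all] p q .
  qed
  have Gadd: "(p \<oplus> p', q \<oplus> q') \<in> G" if pq: "(p, q) \<in> G" and pq': "(p', q') \<in> G" for p q p' q'
  proof -
    have "(p \<oplus> (\<Oplus>k\<in>{..<m}. c k \<odot> e (x k)), q \<oplus> (\<Oplus>k\<in>{..<m}. c k \<odot> g (x k))) \<in> G"
      if "\<forall>k<m. x k \<in> J" for m :: nat and c x
      using that
    proof (induction m)
      case 0
      then show ?case using pq Gcl by simp
    next
      case (Suc m)
      have s: "p \<oplus> (\<Oplus>k\<in>{..<Suc m}. c k \<odot> h (x k)) = (p \<oplus> (\<Oplus>k\<in>{..<m}. c k \<odot> h (x k))) \<oplus> c m \<odot> h (x m)"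
        if h: "\<forall>x\<in>J. h x \<in> carrier H" and p: "p \<in> carrier H" for h p
      proof -
        have "(\<Oplus>k\<in>{..<m}. c k \<odot> h (x k)) \<in> carrier H"
          using Suc.prems h by (intro M.finsum_closed) auto
        then show ?thesis
          unfolding lessThan_Suc using Suc.prems h p
          by (subst M.finsum_insert) (auto simp: M.a_ac)
      qed
      have IH: "(p \<oplus> (\<Oplus>k\<in>{..<m}. c k \<odot> e (x k)), q \<oplus> (\<Oplus>k\<in>{..<m}. c k \<odot> g (x k))) \<in> G"
        using Suc by simp
      show ?case
        unfolding s[OF e_all Gcl(1)[OF pq]] s[OF g_all Gcl(2)[OF pq]]
        using Suc.prems by (intro Gsnoc IH) simp
    qed
    then show ?thesis using pq' unfolding G_def by blast
  qed
  have Gsmult: "(a \<odot> p, a \<odot> q) \<in> G" if pq: "(p, q) \<in> G" for p q a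
  proof -
    obtain m :: nat and c x where x: "\<forall>k<m. x k \<in> J"
      and p: "p = (\<Oplus>k\<in>{..<m}. c k \<odot> e (x k))" and q: "q = (\<Oplus>k\<in>{..<m}. c k \<odot> g (x k))"
      using pq by (auto simp: G_def)
    have s: "a \<odot> (\<Oplus>k\<in>{..<m}. c k \<odot> h (x k)) = (\<Oplus>k\<in>{..<m}. (a * c k) \<odot> h (x k))"
      if h: "\<forall>x\<in>J. h x \<in> carrier H" for h
    proof -
      have h': "h (x k) \<in> carrier H" if "k < m" for k using x h that by blast
      have cl: "(\<Oplus>k\<in>{..<m}. c' k \<odot> h (x k)) \<in> carrier H" for c'
        using h' by (intro M.finsum_closed) auto
      have inner: "hinner H (\<Oplus>k\<in>{..<m}. c' k \<odot> h (x k)) z = (\<Sum>k<m. c' k * hinner H (h (x k)) z)"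
        if "z \<in> carrier H" for c' z
        using h' that by (subst hinner_finsum_left) (auto simp: hinner_smult_left)
      show ?thesis
        using cl
        by (intro hinner_ext) (simp_all add: hinner_left inner sum_distrib_left mult.assoc)
    qed
    show ?thesis unfolding p q s[OF e_all] s[OF g_all] using x by (intro GI) blast
  qed
  have Gdiff: "hnorm H (q \<ominus> q') \<le> hnorm H (p \<ominus> p')"
    if pq: "(p, q) \<in> G" and pq': "(p', q') \<in> G" for p q p' q'
  proof -
    have "(p \<oplus> (-1) \<odot> p', q \<oplus> (-1) \<odot> q') \<in> G" by (intro Gadd Gsmult pq pq')
    then show ?thesis using Gnorm Gcl[OF pq'] by (simp add: M.minus_eq a_inv_eq_smult)
  qed
  have spanG: "v \<in> fst ` G" if v_span: "v \<in> hspan H (e ` J)" for v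
  proof -
    obtain F c where F: "finite F" "F \<subseteq> e ` J" and v: "v = (\<Oplus>u\<in>F. c u \<odot> u)"
      using v_span by (auto simp: hspan_def)
    have "(\<Oplus>u\<in>F. c u \<odot> u) \<in> fst ` G" using F
    proof (induction F)
      case empty
      then show ?case using G0 by force
    next
      case (insert u F)
      obtain x where x: "x \<in> J" "u = e x" using insert.prems by auto
      obtain q where q: "((\<Oplus>u\<in>F. c u \<odot> u), q) \<in> G" using insert by auto
      have Fc: "v \<in> carrier H" if "v \<in> F" for v using insert.prems e that by auto
      have "(\<Oplus>u\<in>insert u F. c u \<odot> u) = (\<Oplus>u\<in>F. c u \<odot> u) \<oplus> c u \<odot> e x"
        using insert.hyps x e Fc Gcl[OF q] by (subst M.finsum_insert) (auto simp: M.a_comm)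
      then show ?case using Gsnoc[OF q x(1), of "c u"] by force
    qed
    then show ?thesis using v by simp
  qed
  have span_cl: "hspan H (e ` J) \<subseteq> carrier H"
    using spanG Gcl by fastforce
  define clG where "clG v w \<longleftrightarrow> w \<in> carrier H \<and>
    (\<forall>r>0. \<exists>p q. (p, q) \<in> G \<and> hnorm H (p \<ominus> v) < r \<and> hnorm H (q \<ominus> w) < r)" for v w
  \<comment> \<open>Approximants of \<open>v\<close> in the span have a Cauchy sequence of partners in \<open>G\<close>; this is where
    completeness enters.\<close>
  have ex: "\<exists>w. clG v w" if v: "v \<in> carrier H" for v
  proof -
    have "\<exists>p q. (p, q) \<in> G \<and> hnorm H (p \<ominus> v) < 1 / real (Suc n)" for n
    proof -
      obtain p where p: "p \<in> hspan H (e ` J)" "hnorm H (p \<ominus> v) < 1 / real (Suc n)"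
        by (rule hdense_approx[OF dense span_cl v, of "1 / real (Suc n)"]) auto
      obtain q where "(p, q) \<in> G" using spanG[OF p(1)] by auto
      then show ?thesis using p(2) by blast
    qed
    then obtain p q where pq: "\<And>n. (p n, q n) \<in> G" "\<And>n. hnorm H (p n \<ominus> v) < 1 / real (Suc n)"
      by metis
    have small: "\<exists>N. \<forall>n\<ge>N. hnorm H (p n \<ominus> v) < r" if "r > 0" for r
    proof -
      obtain N where N: "1 / real (Suc N) < r"
        using reals_Archimedean[OF \<open>r > 0\<close>] by (auto simp: inverse_eq_divide)
      have "hnorm H (p n \<ominus> v) < r" if nN: "n \<ge> N" for n
      proof -
        have "1 / real (Suc n) \<le> 1 / real (Suc N)" using nN by (intro divide_left_mono) auto
        then show ?thesis using pq(2)[of n] N by linarith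
      qed
      then show ?thesis by blast
    qed
    obtain w where w: "w \<in> carrier H" "\<And>r. r > 0 \<Longrightarrow> \<exists>N. \<forall>n\<ge>N. hnorm H (q n \<ominus> w) < r"
    proof (rule limit_exists_if_mcomplete[OF complete, of q])
      show "q n \<in> carrier H" for n using Gcl pq by blast
      fix r :: real assume "r > 0"
      then obtain N where N: "\<And>n. n \<ge> N \<Longrightarrow> hnorm H (p n \<ominus> v) < r / 2"
        using small[of "r / 2"] by auto
      have "hnorm H (q m \<ominus> q n) < r" if "m \<ge> N" "n \<ge> N" for m n
      proof -
        have c: "p m \<in> carrier H" "p n \<in> carrier H" using Gcl pq by blast+
        show ?thesis
          using Gdiff[OF pq(1)[of m] pq(1)[of n]] hnorm_triangle_diff[OF c(1) v c(2)]
            N[OF that(1)] N[OF that(2)] hnorm_diff_commute[OF v c(2)] by simp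
      qed
      then show "\<exists>N. \<forall>m\<ge>N. \<forall>n\<ge>N. hnorm H (q m \<ominus> q n) < r" by blast
    qed blast
    have "clG v w"
      unfolding clG_def
    proof (intro conjI w allI impI)
      fix r :: real assume r: "r > 0"
      obtain N M where "\<forall>n\<ge>N. hnorm H (p n \<ominus> v) < r" "\<forall>n\<ge>M. hnorm H (q n \<ominus> w) < r"
        using small[OF r] w(2)[OF r] by blast
      then show "\<exists>p q. (p, q) \<in> G \<and> hnorm H (p \<ominus> v) < r \<and> hnorm H (q \<ominus> w) < r"
        using pq(1)[of "max N M"] by (meson max.cobounded1 max.cobounded2)
    qed
    then show ?thesis by blast
  qed
  have unique: "w = w'" if w: "clG v w" and w': "clG v w'" and v: "v \<in> carrier H" for v w w'
  proof (rule eq_if_hnorm_diff_arbitrarily_small)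
    show wc: "w \<in> carrier H" "w' \<in> carrier H" using w w' by (simp_all add: clG_def)
    fix r :: real assume "r > 0"
    then have r: "r / 4 > 0" by simp
    obtain p q where pq: "(p, q) \<in> G" "hnorm H (p \<ominus> v) < r / 4" "hnorm H (q \<ominus> w) < r / 4"
      using w r unfolding clG_def by blast
    obtain p' q' where pq': "(p', q') \<in> G" "hnorm H (p' \<ominus> v) < r / 4" "hnorm H (q' \<ominus> w') < r / 4"
      using w' r unfolding clG_def by blast
    note c = Gcl[OF pq(1)] Gcl[OF pq'(1)]
    show "hnorm H (w \<ominus> w') \<le> r"
      using hnorm_triangle_diff[OF wc(1) c(2) wc(2)] hnorm_triangle_diff[OF c(2) c(4) wc(2)]
        hnorm_triangle_diff[OF c(1) v c(3)] Gdiff[OF pq(1) pq'(1)] pq(2,3) pq'(2,3)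
        hnorm_diff_commute[OF wc(1) c(2)] hnorm_diff_commute[OF v c(3)] by linarith
  qed
  define R where "R = (\<lambda>v\<in>carrier H. THE w. clG v w)"
  have R: "R v = w" if "v \<in> carrier H" "clG v w" for v w
    using that unique unfolding R_def by (auto intro: the_equality)
  have clGR: "clG v (R v)" if "v \<in> carrier H" for v using ex R that by blast
  have RG: "R p = q" if pq: "(p, q) \<in> G" for p q
  proof (rule R)
    have "hnorm H (p \<ominus> p) = 0" "hnorm H (q \<ominus> q) = 0"
      using Gcl[OF pq] by (simp_all add: M.minus_eq M.r_neg)
    then show "clG p q"
      unfolding clG_def using pq Gcl[OF pq]
      by (intro conjI allI impI exI[of _ p] exI[of _ q]) simp_all
  qed (rule Gcl[OF pq])
  have Rcl: "R v \<in> carrier H" if "v \<in> carrier H" for v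
    using clGR[OF that] by (simp add: clG_def)
  have Rnorm: "hnorm H (R v) \<le> hnorm H v" if v: "v \<in> carrier H" for v
  proof (rule field_le_epsilon)
    fix r :: real assume "r > 0"
    then have "r / 2 > 0" by simp
    then obtain p q where pq: "(p, q) \<in> G" "hnorm H (p \<ominus> v) < r / 2" "hnorm H (q \<ominus> R v) < r / 2"
      using clGR[OF v] unfolding clG_def by blast
    note c = Gcl[OF pq(1)]
    show "hnorm H (R v) \<le> hnorm H v + r"
      using hnorm_le_add_diff[OF Rcl[OF v] c(2)] hnorm_le_add_diff[OF c(1) v] Gnorm[OF pq(1)] pq(2,3)
        hnorm_diff_commute[OF Rcl[OF v] c(2)] by linarith
  qed
  have "R \<in> bounded_operators H"
  proof (rule bounded_operatorI[of _ 1])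
    show "R \<in> carrier H \<rightarrow>\<^sub>E carrier H" using Rcl by (auto simp: R_def)
    show "R (v \<oplus> v') = R v \<oplus> R v'" if v: "v \<in> carrier H" "v' \<in> carrier H" for v v'
    proof (rule R)
      show "clG (v \<oplus> v') (R v \<oplus> R v')"
        unfolding clG_def
      proof (intro conjI allI impI)
        fix r :: real assume "r > 0"
        then have r: "r / 2 > 0" by simp
        obtain p q where pq: "(p, q) \<in> G" "hnorm H (p \<ominus> v) < r / 2" "hnorm H (q \<ominus> R v) < r / 2"
          using clGR[OF v(1)] r unfolding clG_def by blast
        obtain p' q' where pq': "(p', q') \<in> G" "hnorm H (p' \<ominus> v') < r / 2" "hnorm H (q' \<ominus> R v') < r / 2"
          using clGR[OF v(2)] r unfolding clG_def by blast
        note c = Gcl[OF pq(1)] Gcl[OF pq'(1)]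
        have "hnorm H ((p \<oplus> p') \<ominus> (v \<oplus> v')) < r" "hnorm H ((q \<oplus> q') \<ominus> (R v \<oplus> R v')) < r"
          using hnorm_add_diff_add[OF c(1,3) v] hnorm_add_diff_add[OF c(2,4) Rcl[OF v(1)] Rcl[OF v(2)]]
            pq(2,3) pq'(2,3) by linarith+
        then show "\<exists>p q. (p, q) \<in> G \<and> hnorm H (p \<ominus> (v \<oplus> v')) < r \<and> hnorm H (q \<ominus> (R v \<oplus> R v')) < r"
          using Gadd[OF pq(1) pq'(1)] by blast
      qed (use v Rcl in simp)
    qed (use v in simp)
    show "R (a \<odot> v) = a \<odot> R v" if v: "v \<in> carrier H" for a v
    proof (rule R)
      show "clG (a \<odot> v) (a \<odot> R v)"
        unfolding clG_def
      proof (intro conjI allI impI)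
        fix r :: real assume "r > 0"
        then have r: "r / (cmod a + 1) > 0" by (simp add: add_nonneg_pos)
        obtain p q where pq: "(p, q) \<in> G" "hnorm H (p \<ominus> v) < r / (cmod a + 1)"
          "hnorm H (q \<ominus> R v) < r / (cmod a + 1)"
          using clGR[OF v] r unfolding clG_def by blast
        note c = Gcl[OF pq(1)]
        have small: "cmod a * s < r" if "s < r / (cmod a + 1)" "0 \<le> s" for s
        proof -
          have "s * (cmod a + 1) < r" using that by (simp add: pos_less_divide_eq add_nonneg_pos)
          then show ?thesis using that by (simp add: algebra_simps)
        qed
        have "hnorm H (a \<odot> p \<ominus> a \<odot> v) < r" "hnorm H (a \<odot> q \<ominus> a \<odot> R v) < r"
          using c v Rcl[OF v] pq small by (simp_all add: smult_diff_distrib hnorm_smult hnorm_nonneg)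
        then show "\<exists>p q. (p, q) \<in> G \<and> hnorm H (p \<ominus> a \<odot> v) < r \<and> hnorm H (q \<ominus> a \<odot> R v) < r"
          using Gsmult[OF pq(1)] by blast
      qed (use v Rcl in simp)
    qed (use v in simp)
  qed (use Rnorm in simp)
  moreover have "R (e x) = g x" if "x \<in> J" for x
  proof (rule RG)
    show "(e x, g x) \<in> G"
      using Gsnoc[OF G0 that, of 1] e g that by (simp add: smult_one_complex)
  qed
  ultimately show ?thesis using that Rnorm by blast
qed

end

context complex_inner_space
begin

lemma bounded_operator_eq_if_eq_on_total:
  assumes R: "R \<in> bounded_operators H" and S: "S \<in> bounded_operators H"
    and E: "E \<subseteq> carrier H" and dense: "hdense H (hspan H E)"
    and eq: "\<And>u. u \<in> E \<Longrightarrow> R u = S u"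
  shows "R = S"
proof (rule bounded_operator_ext[OF R S])
  fix v assume v: "v \<in> carrier H"
  note cl = bounded_operator_closed[OF R] bounded_operator_closed[OF S]
  obtain C where C: "C \<ge> 0" "\<And>x. x \<in> carrier H \<Longrightarrow> hnorm H (R x) \<le> C * hnorm H x"
    using bounded_operator_bound[OF R] by blast
  obtain D where D: "D \<ge> 0" "\<And>x. x \<in> carrier H \<Longrightarrow> hnorm H (S x) \<le> D * hnorm H x"
    using bounded_operator_bound[OF S] by blast
  have span: "p \<in> carrier H \<and> R p = S p" if p_span: "p \<in> hspan H E" for p
  proof -
    obtain F c where F: "finite F" "F \<subseteq> E" and p: "p = (\<Oplus>u\<in>F. c u \<odot> u)"
      using p_span by (auto simp: hspan_def)
    have Fc: "u \<in> carrier H" if "u \<in> F" for u using that F E by blast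
    have "R p = (\<Oplus>u\<in>F. R (c u \<odot> u))"
      unfolding p by (rule bounded_operator_finsum[OF R F(1)]) (simp add: Fc)
    moreover have "S p = (\<Oplus>u\<in>F. S (c u \<odot> u))"
      unfolding p by (rule bounded_operator_finsum[OF S F(1)]) (simp add: Fc)
    moreover have "(\<Oplus>u\<in>F. R (c u \<odot> u)) = (\<Oplus>u\<in>F. S (c u \<odot> u))"
      using F Fc eq cl
      by (intro M.finsum_cong') (auto simp: bounded_operator_smult[OF R] bounded_operator_smult[OF S])
    moreover have "p \<in> carrier H"
      unfolding p by (rule M.finsum_closed) (simp add: Fc Pi_def)
    ultimately show ?thesis by simp
  qed
  show "R v = S v"
  proof (rule eq_if_hnorm_diff_arbitrarily_small)
    fix r :: real assume "r > 0"
    then have "r / (C + D + 1) > 0" using C D by simp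
    then obtain p where p: "p \<in> hspan H E" "hnorm H (p \<ominus> v) < r / (C + D + 1)"
      using hdense_approx[OF dense _ v] span by blast
    have pc: "p \<in> carrier H" and Rp: "R p = S p" using span[OF p(1)] by auto
    have "hnorm H (R v \<ominus> S v) \<le> hnorm H (R (p \<ominus> v)) + hnorm H (S (p \<ominus> v))"
      using hnorm_triangle_diff[of "R v" "R p" "S v"] hnorm_diff_commute[of "R v" "R p"] cl v pc
      by (simp add: bounded_operator_diff[OF R] bounded_operator_diff[OF S] Rp)
    also have "\<dots> \<le> C * hnorm H (p \<ominus> v) + D * hnorm H (p \<ominus> v)"
      using C(2)[of "p \<ominus> v"] D(2)[of "p \<ominus> v"] v pc by (intro add_mono) auto
    also have "\<dots> \<le> (C + D + 1) * hnorm H (p \<ominus> v)"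
      using hnorm_nonneg[of "p \<ominus> v"] v pc by (simp add: algebra_simps)
    also have "\<dots> \<le> r"
      using p(2) C(1) D(1) by (simp add: pos_less_divide_eq mult.commute less_imp_le)
    finally show "hnorm H (R v \<ominus> S v) \<le> r" .
  qed (use v cl in auto)
qed

end

section \<open>Tensor products\<close>

context complex_inner_space
begin

text \<open>
  The form at \<open>c\<close> is the difference of the squared norms of \<open>s\<close> and \<open>T s\<close> for the linear
  combination \<open>s\<close> with coefficients \<open>c\<close>.
\<close>

lemma psd_Gram_defect:
  assumes "finite I" and x: "\<And>i. i \<in> I \<Longrightarrow> x i \<in> carrier H"
    and T: "contraction H T"
  shows "psd I (\<lambda>k l. hinner H (x k) (x l) - hinner H (T (x k)) (T (x l)))"
  unfolding psd_def
proof (intro conjI ballI allI)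
  have Tb: "T \<in> bounded_operators H" using T by (simp add: contraction_def)
  note cl = bounded_operator_closed[OF Tb]
  show "cnj (hinner H (x k) (x l) - hinner H (T (x k)) (T (x l))) =
      hinner H (x l) (x k) - hinner H (T (x l)) (T (x k))" if "k \<in> I" "l \<in> I" for k l
    using that assms cl by (simp add: hinner_commute[of "x k" "x l"] hinner_commute[of "T (x k)" "T (x l)"])
  fix c
  define s where "s = (\<Oplus>i\<in>I. c i \<odot> x i)"
  have s: "s \<in> carrier H" unfolding s_def by (intro M.finsum_closed) (simp add: x Pi_def)
  have "T s = (\<Oplus>i\<in>I. T (c i \<odot> x i))"
    unfolding s_def by (rule bounded_operator_finsum[OF Tb \<open>finite I\<close>]) (simp add: x)
  also have "\<dots> = (\<Oplus>i\<in>I. c i \<odot> T (x i))"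
    by (intro M.finsum_cong') (auto simp: bounded_operator_smult[OF Tb] x cl)
  finally have Ts: "T s = (\<Oplus>i\<in>I. c i \<odot> T (x i))" .
  have "hinner H s s = (\<Sum>k\<in>I. \<Sum>l\<in>I. c k * cnj (c l) * hinner H (x k) (x l))"
    unfolding s_def by (rule hinner_finsum_smult[OF \<open>finite I\<close> x])
  moreover have "hinner H (T s) (T s) = (\<Sum>k\<in>I. \<Sum>l\<in>I. c k * cnj (c l) * hinner H (T (x k)) (T (x l)))"
    unfolding Ts by (rule hinner_finsum_smult[OF \<open>finite I\<close> cl[OF x]])
  ultimately have "(\<Sum>k\<in>I. \<Sum>l\<in>I. c k * cnj (c l) * (hinner H (x k) (x l) - hinner H (T (x k)) (T (x l))))
      = hinner H s s - hinner H (T s) (T s)"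
    by (simp only: right_diff_distrib sum_subtractf)
  moreover have "(hnorm H (T s))\<^sup>2 \<le> (hnorm H s)\<^sup>2"
    using contraction_hnorm_le[OF T s] hnorm_nonneg[OF cl[OF s]] by (rule power_mono)
  ultimately show "0 \<le> Re (\<Sum>k\<in>I. \<Sum>l\<in>I. c k * cnj (c l) *
      (hinner H (x k) (x l) - hinner H (T (x k)) (T (x l))))"
    using s cl[OF s] by (simp add: hnorm_sq)
qed

lemma finsum_smult_B_closed:
  assumes "finite A" "\<And>i. i \<in> A \<Longrightarrow> S i \<in> bounded_operators H"
  shows "(\<Oplus>\<^bsub>\<B> H\<^esub>i\<in>A. a i \<odot>\<^bsub>\<B> H\<^esub> S i) \<in> bounded_operators H"
proof -
  interpret B: module complex_field "\<B> H" by (rule module_B)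
  show ?thesis
    using assms B.M.finsum_closed[of "\<lambda>i. a i \<odot>\<^bsub>\<B> H\<^esub> S i" A] by (simp add: Pi_def smult_B_closed)
qed

lemma finsum_smult_B_diff:
  assumes A: "finite A" and S: "\<And>i. i \<in> A \<Longrightarrow> S i \<in> bounded_operators H"
  shows "(\<Oplus>\<^bsub>\<B> H\<^esub>i\<in>A. a i \<odot>\<^bsub>\<B> H\<^esub> S i) \<ominus>\<^bsub>\<B> H\<^esub> (\<Oplus>\<^bsub>\<B> H\<^esub>i\<in>A. b i \<odot>\<^bsub>\<B> H\<^esub> S i) =
    (\<Oplus>\<^bsub>\<B> H\<^esub>i\<in>A. (a i - b i) \<odot>\<^bsub>\<B> H\<^esub> S i)"
proof -
  interpret B: module complex_field "\<B> H" by (rule module_B)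
  let ?F = "\<lambda>c. \<Oplus>\<^bsub>\<B> H\<^esub>i\<in>A. c i \<odot>\<^bsub>\<B> H\<^esub> S i"
  have cl: "?F c \<in> carrier (\<B> H)" for c
    using finsum_smult_B_closed[OF A S] by simp
  have "?F (\<lambda>i. a i - b i) \<oplus>\<^bsub>\<B> H\<^esub> ?F b =
      (\<Oplus>\<^bsub>\<B> H\<^esub>i\<in>A. (a i - b i) \<odot>\<^bsub>\<B> H\<^esub> S i \<oplus>\<^bsub>\<B> H\<^esub> b i \<odot>\<^bsub>\<B> H\<^esub> S i)"
    using S by (intro B.M.finsum_addf[symmetric]) (auto simp: smult_B_closed)
  also have "\<dots> = ?F a"
  proof (rule B.M.finsum_cong')
    show "(a i - b i) \<odot>\<^bsub>\<B> H\<^esub> S i \<oplus>\<^bsub>\<B> H\<^esub> b i \<odot>\<^bsub>\<B> H\<^esub> S i = a i \<odot>\<^bsub>\<B> H\<^esub> S i" if "i \<in> A" for i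
      using B.smult_l_distr[of "a i - b i" "b i" "S i"] S[OF that] by (simp add: ring_of_type_algebra_def)
  qed (use S in \<open>auto simp: smult_B_closed\<close>)
  finally have "?F a = ?F (\<lambda>i. a i - b i) \<oplus>\<^bsub>\<B> H\<^esub> ?F b" ..
  then show ?thesis
    by (simp only: B.M.minus_eq B.M.a_assoc[OF cl cl B.M.a_inv_closed[OF cl]] B.M.r_neg[OF cl]
        B.M.r_zero[OF cl])
qed

text \<open>
  Used twice: with approximate eigenvalues \<open>l i\<close> at a common approximate eigenvector \<open>v\<close>, and with
  \<open>l = 0\<close>, where it is the triangle inequality for the value of the sum at \<open>v\<close>.
\<close>

lemma finsum_smult_B_apply_approx:
  assumes A: "finite A" and S: "\<And>i. i \<in> A \<Longrightarrow> S i \<in> bounded_operators H"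
    and v: "v \<in> carrier H"
  shows "hnorm H ((\<Oplus>\<^bsub>\<B> H\<^esub>i\<in>A. a i \<odot>\<^bsub>\<B> H\<^esub> S i) v \<ominus> (\<Sum>i\<in>A. a i * l i) \<odot> v) \<le>
    (\<Sum>i\<in>A. cmod (a i) * hnorm H (S i v \<ominus> l i \<odot> v))"
proof -
  interpret B: module complex_field "\<B> H" by (rule module_B)
  show ?thesis
    using A S
  proof (induction A)
    case empty
    have "\<zero> \<ominus> 0 \<odot> v = \<zero>" using v by (intro hinner_ext) (simp_all add: hinner_left)
    then show ?case using v by (simp add: zero_B_apply)
  next
    case (insert i A)
    have Si: "S i \<in> bounded_operators H" and SA: "\<And>j. j \<in> A \<Longrightarrow> S j \<in> bounded_operators H"
      using insert.prems by auto
    let ?F = "\<Oplus>\<^bsub>\<B> H\<^esub>i\<in>A. a i \<odot>\<^bsub>\<B> H\<^esub> S i"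
    have F: "?F \<in> bounded_operators H" by (rule finsum_smult_B_closed[OF insert.hyps(1) SA])
    note cl = bounded_operator_closed[OF F v] bounded_operator_closed[OF Si v]
    have "(\<Oplus>\<^bsub>\<B> H\<^esub>i\<in>insert i A. a i \<odot>\<^bsub>\<B> H\<^esub> S i) = a i \<odot>\<^bsub>\<B> H\<^esub> S i \<oplus>\<^bsub>\<B> H\<^esub> ?F"
      using insert.hyps by (intro B.M.finsum_insert) (auto simp: smult_B_closed Si SA)
    then have "(\<Oplus>\<^bsub>\<B> H\<^esub>i\<in>insert i A. a i \<odot>\<^bsub>\<B> H\<^esub> S i) v = a i \<odot> S i v \<oplus> ?F v"
      using v by (simp add: add_B_apply smult_B_apply)
    moreover have "a i \<odot> S i v \<oplus> ?F v \<ominus> (\<Sum>i\<in>insert i A. a i * l i) \<odot> v =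
        a i \<odot> (S i v \<ominus> l i \<odot> v) \<oplus> (?F v \<ominus> (\<Sum>i\<in>A. a i * l i) \<odot> v)"
      using cl v insert.hyps by (intro hinner_ext) (simp_all add: hinner_left algebra_simps)
    moreover have "hnorm H \<dots> \<le> cmod (a i) * hnorm H (S i v \<ominus> l i \<odot> v) +
        (\<Sum>i\<in>A. cmod (a i) * hnorm H (S i v \<ominus> l i \<odot> v))"
      using insert.IH[OF SA] cl v
        hnorm_triangle[of "a i \<odot> (S i v \<ominus> l i \<odot> v)" "?F v \<ominus> (\<Sum>i\<in>A. a i * l i) \<odot> v"]
      by (simp add: hnorm_smult)
    ultimately show ?case using insert.hyps by simp
  qed
qed

end

locale tensor_product_space =
  fixes n :: nat and H :: "nat \<Rightarrow> 'a hspace" and K :: "'k hspace" and \<tau> :: "(nat \<Rightarrow> 'a) \<Rightarrow> 'k"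
  assumes factor: "\<And>i. i \<in> {1..n} \<Longrightarrow> complex_hilbert_space (H i)"
    and tensor: "hilbert_tensor_product n H K \<tau>"
begin

sublocale K: complex_hilbert_space K
  using tensor by (simp add: hilbert_tensor_product_def)

abbreviation P :: "(nat \<Rightarrow> 'a) set" where
  "P \<equiv> \<Pi>\<^sub>E i\<in>{1..n}. carrier (H i)"

lemma factor_inner: "i \<in> {1..n} \<Longrightarrow> complex_inner_space (H i)"
  using factor complex_hilbert_space.axioms(1) by blast

lemma tensor_closed: "x \<in> P \<Longrightarrow> \<tau> x \<in> carrier K"
  using tensor unfolding hilbert_tensor_product_def by blast

lemma tensor_add:
  assumes "x \<in> P" "i \<in> {1..n}" "u \<in> carrier (H i)" "v \<in> carrier (H i)"
  shows "\<tau> (x(i := u \<oplus>\<^bsub>H i\<^esub> v)) = \<tau> (x(i := u)) \<oplus>\<^bsub>K\<^esub> \<tau> (x(i := v))"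
proof -
  have "\<forall>x \<in> P. \<forall>i\<in>{1..n}. \<forall>u\<in>carrier (H i). \<forall>v\<in>carrier (H i).
        \<tau> (x(i := u \<oplus>\<^bsub>H i\<^esub> v)) = \<tau> (x(i := u)) \<oplus>\<^bsub>K\<^esub> \<tau> (x(i := v))"
    using tensor unfolding hilbert_tensor_product_def by (elim conjE)
  then show ?thesis using assms by blast
qed

lemma tensor_smult:
  assumes "x \<in> P" "i \<in> {1..n}" "u \<in> carrier (H i)"
  shows "\<tau> (x(i := c \<odot>\<^bsub>H i\<^esub> u)) = c \<odot>\<^bsub>K\<^esub> \<tau> (x(i := u))"
proof -
  have "\<forall>x \<in> P. \<forall>i\<in>{1..n}. \<forall>c. \<forall>u\<in>carrier (H i).
        \<tau> (x(i := c \<odot>\<^bsub>H i\<^esub> u)) = c \<odot>\<^bsub>K\<^esub> \<tau> (x(i := u))"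
    using tensor unfolding hilbert_tensor_product_def by (elim conjE)
  then show ?thesis using assms by blast
qed

lemma hinner_tensor:
  assumes "x \<in> P" "y \<in> P"
  shows "hinner K (\<tau> x) (\<tau> y) = (\<Prod>i=1..n. hinner (H i) (x i) (y i))"
  using tensor assms unfolding hilbert_tensor_product_def by (elim conjE) blast

lemma tensors_dense: "hdense K (hspan K (\<tau> ` P))"
  using tensor unfolding hilbert_tensor_product_def by (elim conjE)

lemma hnorm_tensor:
  assumes x: "x \<in> P"
  shows "hnorm K (\<tau> x) = (\<Prod>i=1..n. hnorm (H i) (x i))"
proof -
  have "hinner (H i) (x i) (x i) = of_real ((hnorm (H i) (x i))\<^sup>2)" if "i \<in> {1..n}" for i
  proof -
    interpret Hi: complex_inner_space "H i" using that by (rule factor_inner)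
    have "x i \<in> carrier (H i)" using x that by blast
    then show ?thesis using Hi.hinner_self_Re Hi.hnorm_sq by simp
  qed
  then have "hinner K (\<tau> x) (\<tau> x) = (\<Prod>i=1..n. of_real ((hnorm (H i) (x i))\<^sup>2))"
    unfolding hinner_tensor[OF x x] by (intro prod.cong) auto
  also have "\<dots> = of_real ((\<Prod>i=1..n. hnorm (H i) (x i))\<^sup>2)"
    by (simp add: prod_power_distrib)
  finally have "(hnorm K (\<tau> x))\<^sup>2 = (\<Prod>i=1..n. hnorm (H i) (x i))\<^sup>2"
    using tensor_closed[OF x] by (simp only: K.hnorm_sq Re_complex_of_real)
  moreover have "0 \<le> (\<Prod>i=1..n. hnorm (H i) (x i))"
  proof (rule prod_nonneg)
    fix i assume i: "i \<in> {1..n}"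
    interpret Hi: complex_inner_space "H i" using i by (rule factor_inner)
    show "0 \<le> hnorm (H i) (x i)" using x i by (intro Hi.hnorm_nonneg) blast
  qed
  ultimately show ?thesis
    using K.hnorm_nonneg[OF tensor_closed[OF x]] by (simp add: power2_eq_iff_nonneg)
qed

lemma upd_in_P: "x \<in> P \<Longrightarrow> i \<in> {1..n} \<Longrightarrow> u \<in> carrier (H i) \<Longrightarrow> x(i := u) \<in> P"
  by (auto simp: PiE_iff extensional_def)

text \<open>
  The difference of the squared norms is the quadratic form of the matrix with entries
  \<open>(\<Prod>j\<noteq>i. \<langle>x k j, x l j\<rangle>) * (\<langle>x k i, x l i\<rangle> - \<langle>T (x k i), T (x l i)\<rangle>)\<close>. This is an entrywise product
  of Gram matrices and of the defect matrix of \<open>T\<close>, so Schur's theorem applies.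
\<close>

lemma factor_contraction_on_span:
  assumes i: "i \<in> {1..n}" and T: "contraction (H i) T"
    and x: "\<And>k. k < m \<Longrightarrow> x k \<in> P"
  shows "hnorm K (\<Oplus>\<^bsub>K\<^esub>k\<in>{..<m::nat}. c k \<odot>\<^bsub>K\<^esub> \<tau> ((x k)(i := T (x k i))))
    \<le> hnorm K (\<Oplus>\<^bsub>K\<^esub>k\<in>{..<m}. c k \<odot>\<^bsub>K\<^esub> \<tau> (x k))"
proof -
  interpret Hi: complex_inner_space "H i" using i by (rule factor_inner)
  have Tb: "T \<in> bounded_operators (H i)" using T by (simp add: contraction_def)
  have xj: "x k j \<in> carrier (H j)" if "k < m" "j \<in> {1..n}" for k j
    using x[OF that(1)] that(2) by blast
  define y where "y k = (x k)(i := T (x k i))" for k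
  have y: "y k \<in> P" if "k < m" for k
    unfolding y_def using that x xj i Hi.bounded_operator_closed[OF Tb] by (intro upd_in_P) auto
  have tx: "\<tau> (x k) \<in> carrier K" and ty: "\<tau> (y k) \<in> carrier K" if "k < m" for k
    using tensor_closed x[OF that] y[OF that] by blast+
  define p where "p = (\<Oplus>\<^bsub>K\<^esub>k\<in>{..<m}. c k \<odot>\<^bsub>K\<^esub> \<tau> (x k))"
  define q where "q = (\<Oplus>\<^bsub>K\<^esub>k\<in>{..<m}. c k \<odot>\<^bsub>K\<^esub> \<tau> (y k))"
  have pq: "p \<in> carrier K" "q \<in> carrier K"
    unfolding p_def q_def using tx ty by (auto intro!: K.M.finsum_closed)
  have "psd {..<m} (\<lambda>k l. (\<Prod>j\<in>{1..n} - {i}. hinner (H j) (x k j) (x l j)) *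
     (hinner (H i) (x k i) (x l i) - hinner (H i) (T (x k i)) (T (x l i))))"
  proof (intro psd_schur_product psd_prod)
    show "psd {..<m} (\<lambda>k l. hinner (H j) (x k j) (x l j))" if "j \<in> {1..n} - {i}" for j
      using that xj by (intro complex_inner_space.psd_Gram factor_inner) auto
    show "psd {..<m} (\<lambda>k l. hinner (H i) (x k i) (x l i) - hinner (H i) (T (x k i)) (T (x l i)))"
      using xj i T by (intro Hi.psd_Gram_defect) auto
  qed auto
  then have "psd {..<m} (\<lambda>k l. hinner K (\<tau> (x k)) (\<tau> (x l)) - hinner K (\<tau> (y k)) (\<tau> (y l)))"
  proof (rule psd_cong)
    fix k l assume "k \<in> {..<m}" "l \<in> {..<m}"
    then have kl: "k < m" "l < m" by auto
    have xx: "hinner K (\<tau> (x k)) (\<tau> (x l)) = hinner (H i) (x k i) (x l i) *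
        (\<Prod>j\<in>{1..n} - {i}. hinner (H j) (x k j) (x l j))"
      unfolding hinner_tensor[OF x[OF kl(1)] x[OF kl(2)]]
      by (rule prod.remove) (use i in auto)
    have "hinner K (\<tau> (y k)) (\<tau> (y l)) = hinner (H i) (y k i) (y l i) *
        (\<Prod>j\<in>{1..n} - {i}. hinner (H j) (y k j) (y l j))"
      unfolding hinner_tensor[OF y[OF kl(1)] y[OF kl(2)]]
      by (rule prod.remove) (use i in auto)
    also have "\<dots> = hinner (H i) (T (x k i)) (T (x l i)) *
        (\<Prod>j\<in>{1..n} - {i}. hinner (H j) (x k j) (x l j))"
      by (simp add: y_def)
    finally show "(\<Prod>j\<in>{1..n} - {i}. hinner (H j) (x k j) (x l j)) *
        (hinner (H i) (x k i) (x l i) - hinner (H i) (T (x k i)) (T (x l i))) =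
        hinner K (\<tau> (x k)) (\<tau> (x l)) - hinner K (\<tau> (y k)) (\<tau> (y l))"
      unfolding xx by (simp add: algebra_simps)
  qed
  from psd_nonneg[OF this, of c]
  have "0 \<le> Re ((\<Sum>k<m. \<Sum>l<m. c k * cnj (c l) * hinner K (\<tau> (x k)) (\<tau> (x l))) -
      (\<Sum>k<m. \<Sum>l<m. c k * cnj (c l) * hinner K (\<tau> (y k)) (\<tau> (y l))))"
    by (simp only: right_diff_distrib sum_subtractf)
  also have "(\<Sum>k<m. \<Sum>l<m. c k * cnj (c l) * hinner K (\<tau> (x k)) (\<tau> (x l))) = hinner K p p"
    unfolding p_def by (rule K.hinner_finsum_smult[symmetric]) (auto simp: tx)
  also have "(\<Sum>k<m. \<Sum>l<m. c k * cnj (c l) * hinner K (\<tau> (y k)) (\<tau> (y l))) = hinner K q q"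
    unfolding q_def by (rule K.hinner_finsum_smult[symmetric]) (auto simp: ty)
  finally have "(hnorm K q)\<^sup>2 \<le> (hnorm K p)\<^sup>2"
    using pq by (simp add: K.hnorm_sq)
  then show ?thesis
    unfolding p_def[symmetric] q_def[unfolded y_def, symmetric]
    by (rule power2_le_imp_le) (use pq K.hnorm_nonneg in simp)
qed

text \<open>
  The description of \<open>ampliation\<close> determines at most one operator because elementary tensors span
  a dense subspace; that there is one is the content of \<open>factor_contraction_on_span\<close> and \<open>extend_contraction\<close>.
\<close>

lemma ampliation:
  assumes i: "i \<in> {1..n}" and T: "contraction (H i) T"
  shows ampliation_bounded: "ampliation n H K \<tau> i T \<in> bounded_operators K"
    and ampliation_tensor: "x \<in> P \<Longrightarrow> ampliation n H K \<tau> i T (\<tau> x) = \<tau> (x(i := T (x i)))"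
    and ampliation_contractive: "v \<in> carrier K \<Longrightarrow> hnorm K (ampliation n H K \<tau> i T v) \<le> hnorm K v"
proof -
  interpret Hi: complex_inner_space "H i" using i by (rule factor_inner)
  have Tb: "T \<in> bounded_operators (H i)" using T by (simp add: contraction_def)
  have TP: "x(i := T (x i)) \<in> P" if x: "x \<in> P" for x
  proof -
    have "x i \<in> carrier (H i)" using x i by blast
    then show ?thesis by (intro upd_in_P x i Hi.bounded_operator_closed[OF Tb])
  qed
  obtain R where R: "R \<in> bounded_operators K" "\<And>x. x \<in> P \<Longrightarrow> R (\<tau> x) = \<tau> (x(i := T (x i)))"
    "\<And>v. v \<in> carrier K \<Longrightarrow> hnorm K (R v) \<le> hnorm K v"
  proof (rule K.extend_contraction[of P \<tau> "\<lambda>x. \<tau> (x(i := T (x i)))"])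
    show "hdense K (hspan K (\<tau> ` P))" by (rule tensors_dense)
    show "hnorm K (\<Oplus>\<^bsub>K\<^esub>k\<in>{..<m}. c k \<odot>\<^bsub>K\<^esub> \<tau> ((x k)(i := T (x k i))))
      \<le> hnorm K (\<Oplus>\<^bsub>K\<^esub>k\<in>{..<m}. c k \<odot>\<^bsub>K\<^esub> \<tau> (x k))" if "\<And>k. k < m \<Longrightarrow> x k \<in> P" for m :: nat and c x
      by (rule factor_contraction_on_span[OF i T that])
  qed (use TP tensor_closed in auto)
  have acts: "(\<lambda>j\<in>{1..n}. (if j = i then T else \<one>\<^bsub>\<B> (H j)\<^esub>) (x j)) = x(i := T (x i))"
    if x: "x \<in> P" for x
  proof
    fix j
    show "(\<lambda>j\<in>{1..n}. (if j = i then T else \<one>\<^bsub>\<B> (H j)\<^esub>) (x j)) j = (x(i := T (x i))) j"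
      using x i by (cases "j \<in> {1..n}")
        (auto simp: complex_inner_space.one_B_apply[OF factor_inner] PiE_iff extensional_def)
  qed
  have "ampliation n H K \<tau> i T = R"
    unfolding ampliation_def tensor_op_def
  proof (rule the_equality)
    show "R \<in> carrier (\<B> K) \<and> (\<forall>x\<in>P. R (\<tau> x) = \<tau> (\<lambda>j\<in>{1..n}. (if j = i then T else \<one>\<^bsub>\<B> (H j)\<^esub>) (x j)))"
      using R acts by simp
    show "S = R" if S: "S \<in> carrier (\<B> K) \<and>
      (\<forall>x\<in>P. S (\<tau> x) = \<tau> (\<lambda>j\<in>{1..n}. (if j = i then T else \<one>\<^bsub>\<B> (H j)\<^esub>) (x j)))" for S
    proof (rule K.bounded_operator_eq_if_eq_on_total[OF _ R(1) _ tensors_dense])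
      show "S \<in> bounded_operators K" using S by simp
      show "\<tau> ` P \<subseteq> carrier K" using tensor_closed by blast
      show "S u = R u" if "u \<in> \<tau> ` P" for u using that S R(2) acts by auto
    qed
  qed
  then show "ampliation n H K \<tau> i T \<in> bounded_operators K"
    "x \<in> P \<Longrightarrow> ampliation n H K \<tau> i T (\<tau> x) = \<tau> (x(i := T (x i)))"
    "v \<in> carrier K \<Longrightarrow> hnorm K (ampliation n H K \<tau> i T v) \<le> hnorm K v"
    using R by simp_all
qed

text \<open>
  By multilinearity the vector on the left is the elementary tensor of \<open>x\<close> with \<open>T (x i) - l * x i\<close> in
  place of \<open>x i\<close>. Thus a tensor of unit vectors that are approximate eigenvectors in each factor is an
  approximate eigenvector for all ampliations simultaneously.
\<close>

lemma ampliation_approx_eigenvector: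
  assumes i: "i \<in> {1..n}" and T: "contraction (H i) T" and x: "x \<in> P"
    and unit: "\<And>j. j \<in> {1..n} \<Longrightarrow> hnorm (H j) (x j) = 1"
  shows "hnorm K (ampliation n H K \<tau> i T (\<tau> x) \<ominus>\<^bsub>K\<^esub> l \<odot>\<^bsub>K\<^esub> \<tau> x) =
    hnorm (H i) (T (x i) \<ominus>\<^bsub>H i\<^esub> l \<odot>\<^bsub>H i\<^esub> x i)"
proof -
  interpret Hi: complex_inner_space "H i" using i by (rule factor_inner)
  have xi: "x i \<in> carrier (H i)" using x i by blast
  have Tb: "T \<in> bounded_operators (H i)" using T by (simp add: contraction_def)
  have Txi: "T (x i) \<in> carrier (H i)" by (rule Hi.bounded_operator_closed[OF Tb xi])
  define d where "d = T (x i) \<ominus>\<^bsub>H i\<^esub> l \<odot>\<^bsub>H i\<^esub> x i"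
  have d: "d \<in> carrier (H i)" using xi Txi by (simp add: d_def)
  have P: "x(i := d) \<in> P" "x(i := T (x i)) \<in> P" by (intro upd_in_P x i d Txi)+
  have "T (x i) = d \<oplus>\<^bsub>H i\<^esub> l \<odot>\<^bsub>H i\<^esub> x i"
    using xi Txi unfolding d_def by (intro Hi.hinner_ext) (simp_all add: Hi.hinner_left)
  then have "\<tau> (x(i := T (x i))) = \<tau> (x(i := d)) \<oplus>\<^bsub>K\<^esub> l \<odot>\<^bsub>K\<^esub> \<tau> x"
    using tensor_add[OF x i d, of "l \<odot>\<^bsub>H i\<^esub> x i"] tensor_smult[OF x i xi, of l] xi by simp
  then have "\<tau> (x(i := T (x i))) \<ominus>\<^bsub>K\<^esub> l \<odot>\<^bsub>K\<^esub> \<tau> x = \<tau> (x(i := d))"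
    using tensor_closed[OF P(1)] tensor_closed[OF x]
    by (intro K.hinner_ext) (simp_all add: K.hinner_left)
  then have "hnorm K (ampliation n H K \<tau> i T (\<tau> x) \<ominus>\<^bsub>K\<^esub> l \<odot>\<^bsub>K\<^esub> \<tau> x) =
      (\<Prod>j=1..n. hnorm (H j) ((x(i := d)) j))"
    by (simp only: ampliation_tensor[OF i T x] hnorm_tensor[OF P(1)])
  also have "\<dots> = hnorm (H i) d * (\<Prod>j\<in>{1..n} - {i}. hnorm (H j) ((x(i := d)) j))"
    using i by (subst prod.remove[of _ i]) auto
  also have "(\<Prod>j\<in>{1..n} - {i}. hnorm (H j) ((x(i := d)) j)) = 1"
    using unit by (intro prod.neutral) auto
  finally show ?thesis by (simp add: d_def)
qed

text \<open>
  The upper bound is the triangle inequality. For the lower bound, \<open>l i\<close> is the unimodular number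
  with \<open>a i * l i = \<bar>a i\<bar>\<close>; at a tensor \<open>v\<close> of unit vectors \<open>u i\<close> with \<open>T i (u i)\<close> close to
  \<open>l i * u i\<close>, the operator acts almost as multiplication by \<open>\<Sum>i. \<bar>a i\<bar>\<close>.
\<close>

lemma opnorm_sum_ampliations:
  assumes T: "\<And>i. i \<in> {1..n} \<Longrightarrow> contraction (H i) (T i)"
    and circle: "\<And>i. i \<in> {1..n} \<Longrightarrow> sphere 0 1 \<subseteq> spectrum (H i) (T i)"
  shows "opnorm K (\<Oplus>\<^bsub>\<B> K\<^esub>i\<in>{1..n}. a i \<odot>\<^bsub>\<B> K\<^esub> ampliation n H K \<tau> i (T i)) = (\<Sum>i=1..n. cmod (a i))"
    (is "opnorm K ?F = ?s")
proof (rule order.antisym)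
  define S where "S i = ampliation n H K \<tau> i (T i)" for i
  have S: "S i \<in> bounded_operators K" if "i \<in> {1..n}" for i
    unfolding S_def using that T by (intro ampliation_bounded)
  have Snorm: "hnorm K (S i v) \<le> hnorm K v" if "i \<in> {1..n}" "v \<in> carrier K" for i v
    unfolding S_def using that T by (intro ampliation_contractive)
  have F: "?F \<in> bounded_operators K"
    using K.finsum_smult_B_closed[OF _ S, of "{1..n}"] by (simp add: S_def)
  have approx: "hnorm K (?F v \<ominus>\<^bsub>K\<^esub> (\<Sum>i=1..n. a i * l i) \<odot>\<^bsub>K\<^esub> v) \<le>
      (\<Sum>i=1..n. cmod (a i) * hnorm K (S i v \<ominus>\<^bsub>K\<^esub> l i \<odot>\<^bsub>K\<^esub> v))" if "v \<in> carrier K" for v l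
    using K.finsum_smult_B_apply_approx[OF _ S that, of "{1..n}"] by (simp add: S_def)
  show "opnorm K ?F \<le> ?s"
  proof (rule K.opnorm_le)
    fix v assume v: "v \<in> carrier K"
    have z: "w \<ominus>\<^bsub>K\<^esub> 0 \<odot>\<^bsub>K\<^esub> v = w" if "w \<in> carrier K" for w
      using that v by (intro K.hinner_ext) (simp_all add: K.hinner_left)
    have "hnorm K (?F v) \<le> (\<Sum>i=1..n. cmod (a i) * hnorm K (S i v \<ominus>\<^bsub>K\<^esub> 0 \<odot>\<^bsub>K\<^esub> v))"
      using approx[OF v, of "\<lambda>_. 0"]
      unfolding mult_zero_right sum.neutral_const z[OF K.bounded_operator_closed[OF F v]] .
    also have "\<dots> \<le> (\<Sum>i=1..n. cmod (a i) * hnorm K v)"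
      using v Snorm by (intro sum_mono mult_left_mono) (simp_all add: z K.bounded_operator_closed[OF S])
    finally show "hnorm K (?F v) \<le> ?s * hnorm K v" by (simp add: sum_distrib_right)
  qed (simp add: sum_nonneg)
  show "?s \<le> opnorm K ?F"
  proof (rule field_le_epsilon)
    fix r :: real assume r: "r > 0"
    \<comment> \<open>The summand \<open>1\<close> keeps the denominator positive when \<open>a = 0\<close>.\<close>
    define e where "e = r / (?s + 1)"
    have s0: "?s \<ge> 0" by (simp add: sum_nonneg)
    have e: "e > 0" "?s * e \<le> r" using r s0 by (simp_all add: e_def field_simps)
    \<comment> \<open>For \<open>a i = 0\<close> any unimodular value serves; \<open>cnj (sgn 0) = 0\<close> would not be one.\<close>
    define l where "l i = (if a i = 0 then 1 else cnj (sgn (a i)))" for i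
    have l: "cmod (l i) = 1" for i by (simp add: l_def norm_sgn)
    have al: "a i * l i = of_real (cmod (a i))" for i
      by (simp add: l_def sgn_div_norm scaleR_conv_of_real complex_norm_square[symmetric]
          power2_eq_square field_simps)
    have "\<exists>u. u \<in> carrier (H i) \<and> hnorm (H i) u = 1 \<and>
        hnorm (H i) (T i u \<ominus>\<^bsub>H i\<^esub> l i \<odot>\<^bsub>H i\<^esub> u) < e" if i: "i \<in> {1..n}" for i
    proof -
      have "l i \<in> spectrum (H i) (T i)" using circle[OF i] l by (auto simp: dist_norm)
      then show ?thesis
        using complex_hilbert_space.contraction_approx_eigenvector[OF factor[OF i] T[OF i] l _ e(1)]
        by blast
    qed
    then obtain u where u: "\<And>i. i \<in> {1..n} \<Longrightarrow> u i \<in> carrier (H i)"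
      "\<And>i. i \<in> {1..n} \<Longrightarrow> hnorm (H i) (u i) = 1"
      "\<And>i. i \<in> {1..n} \<Longrightarrow> hnorm (H i) (T i (u i) \<ominus>\<^bsub>H i\<^esub> l i \<odot>\<^bsub>H i\<^esub> u i) < e"
      by metis
    define x where "x = (\<lambda>i\<in>{1..n}. u i)"
    have x: "x \<in> P" "\<And>i. i \<in> {1..n} \<Longrightarrow> x i = u i" using u by (auto simp: x_def)
    define v where "v = \<tau> x"
    have v: "v \<in> carrier K" "hnorm K v = 1"
      using tensor_closed[OF x(1)] hnorm_tensor[OF x(1)] u(2) x(2) by (simp_all add: v_def)
    have Fv: "?F v \<in> carrier K" by (rule K.bounded_operator_closed[OF F v(1)])
    have sl: "(\<Sum>i=1..n. a i * l i) = of_real ?s" by (simp add: al)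
    have "hnorm K (S i v \<ominus>\<^bsub>K\<^esub> l i \<odot>\<^bsub>K\<^esub> v) \<le> e" if "i \<in> {1..n}" for i
      using ampliation_approx_eigenvector[OF that T[OF that] x(1), of "l i"] u x(2) that
      by (simp add: S_def v_def less_imp_le)
    then have "(\<Sum>i=1..n. cmod (a i) * hnorm K (S i v \<ominus>\<^bsub>K\<^esub> l i \<odot>\<^bsub>K\<^esub> v)) \<le> (\<Sum>i=1..n. cmod (a i) * e)"
      by (intro sum_mono mult_left_mono) auto
    then have "hnorm K (?F v \<ominus>\<^bsub>K\<^esub> of_real ?s \<odot>\<^bsub>K\<^esub> v) \<le> r"
      using approx[OF v(1), of l] e(2) unfolding sl sum_distrib_right[symmetric] by linarith
    moreover have "hnorm K (of_real ?s \<odot>\<^bsub>K\<^esub> v) = ?s"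
      using v s0 by (simp add: K.hnorm_smult del: of_real_sum)
    moreover have "hnorm K (of_real ?s \<odot>\<^bsub>K\<^esub> v) \<le> hnorm K (?F v) + hnorm K (?F v \<ominus>\<^bsub>K\<^esub> of_real ?s \<odot>\<^bsub>K\<^esub> v)"
      using K.hnorm_le_add_diff[of "of_real ?s \<odot>\<^bsub>K\<^esub> v" "?F v"]
        K.hnorm_diff_commute[of "of_real ?s \<odot>\<^bsub>K\<^esub> v" "?F v"] Fv v(1) by simp
    moreover have "hnorm K (?F v) \<le> opnorm K ?F"
      using v by (intro K.hnorm_le_opnorm[OF F]) auto
    ultimately show "?s \<le> opnorm K ?F + r" by linarith
  qed
qed

end

theorem theorem1p20:
  fixes n :: nat
    and H :: "nat \<Rightarrow> 'a hspace"
    and T :: "nat \<Rightarrow> 'a \<Rightarrow> 'a"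
    and K :: "'k hspace"
    and \<tau> :: "(nat \<Rightarrow> 'a) \<Rightarrow> 'k"
  assumes "n \<ge> 1"
    and "\<And>i. i \<in> {1..n} \<Longrightarrow> complex_hilbert_space (H i)"
    and "\<And>i. i \<in> {1..n} \<Longrightarrow> contraction (H i) (T i)"
    and "\<And>i. i \<in> {1..n} \<Longrightarrow> sphere 0 1 \<subseteq> spectrum (H i) (T i)"
    and "hilbert_tensor_product n H K \<tau>"
  shows "isometry_into (ell1 n) (ell1_dist n) (carrier (\<B> K)) (op_dist K)
    (\<lambda>a. \<Oplus>\<^bsub>\<B> K\<^esub>i\<in>{1..n}. a i \<odot>\<^bsub>\<B> K\<^esub> ampliation n H K \<tau> i (T i))"
proof -
  interpret tensor_product_space n H K \<tau>
    using assms(2,5) by (rule tensor_product_space.intro)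
  define S where "S i = ampliation n H K \<tau> i (T i)" for i
  have S: "S i \<in> bounded_operators K" if "i \<in> {1..n}" for i
    unfolding S_def using that assms(3) by (intro ampliation_bounded)
  have norm: "opnorm K (\<Oplus>\<^bsub>\<B> K\<^esub>i\<in>{1..n}. a i \<odot>\<^bsub>\<B> K\<^esub> S i) = (\<Sum>i=1..n. cmod (a i))" for a
    unfolding S_def using assms(3,4) by (rule opnorm_sum_ampliations)
  show ?thesis
    unfolding isometry_into_def S_def[symmetric]
  proof (intro conjI ballI funcsetI)
    show "(\<Oplus>\<^bsub>\<B> K\<^esub>i\<in>{1..n}. a i \<odot>\<^bsub>\<B> K\<^esub> S i) \<in> carrier (\<B> K)" for a
      using K.finsum_smult_B_closed[OF _ S, of "{1..n}"] by simp
    show "op_dist K (\<Oplus>\<^bsub>\<B> K\<^esub>i\<in>{1..n}. a i \<odot>\<^bsub>\<B> K\<^esub> S i) (\<Oplus>\<^bsub>\<B> K\<^esub>i\<in>{1..n}. b i \<odot>\<^bsub>\<B> K\<^esub> S i) = ell1_dist n a b" for a b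
    proof -
      have diff: "(\<Oplus>\<^bsub>\<B> K\<^esub>i\<in>{1..n}. a i \<odot>\<^bsub>\<B> K\<^esub> S i) \<ominus>\<^bsub>\<B> K\<^esub> (\<Oplus>\<^bsub>\<B> K\<^esub>i\<in>{1..n}. b i \<odot>\<^bsub>\<B> K\<^esub> S i) =
          (\<Oplus>\<^bsub>\<B> K\<^esub>i\<in>{1..n}. (a i - b i) \<odot>\<^bsub>\<B> K\<^esub> S i)"
        by (rule K.finsum_smult_B_diff) (auto intro: S)
      show ?thesis
        unfolding op_dist_def diff norm by (simp add: ell1_dist_def ell1_norm_def)
    qed
  qed
qed

end
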